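(* Let $q=5^r$ with $r\ge1$, and let $t_1,t_2,t_3\in\mathbb{F}_q$. Then $$\psi_q(60,t_1,t_2,t_3)=q^{57}-q^{28}\left(2q^2\cdot 1_{t_1=t_2=t_3=0}-q\cdot 1_{t_1=t_2=0}-1_{t_1=0}\right).$$
   Context: $\mathbb{F}_q$ is the finite field with $q$ elements; $\mathcal{M}_{n,q}$ is the set of monic polynomials of degree $n$ in $\mathbb{F}_q[T]$. The $j$-th next-to-leading coefficient of a monic polynomial $f$ of degree $n$ is the coefficient of $T^{n-j}$ in $f$. The von Mangoldt function is $\Lambda_q(f)=\deg P$ if $f=P^k$ with $P$ monic irreducible and $k\ge1$, and $\Lambda_q(f)=0$ otherwise. $\psi_q(n,t_1,t_2,t_3)=\sum \Lambda_q(f)$, the sum being over all $f\in\mathcal{M}_{n,q}$ whose first $3$ next-to-leading coefficients are $t_1,t_2,t_3$. $1_{E}$ equals $1$ if the condition $E$ holds and $0$ otherwise. *)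

theory Defs
  imports "HOL-Computational_Algebra.Computational_Algebra" "HOL-Library.Cardinality"
begin

definition monic_polys :: "nat \<Rightarrow> 'a::finite_field poly set" where
  "monic_polys n = {f. degree f = n \<and> lead_coeff f = 1}"

(* The case distinction prevents truncated subtraction: a polynomial of degree
   less than j has no coefficient of T^(n-j), which is read as 0. *)
definition next_to_leading :: "nat \<Rightarrow> 'a::finite_field poly \<Rightarrow> 'a" where
  "next_to_leading j f = (if j \<le> degree f then coeff f (degree f - j) else 0)"

definition is_power_of_monic_irreducible :: "'a::finite_field poly \<Rightarrow> 'a poly \<Rightarrow> bool" where
  "is_power_of_monic_irreducible f P \<longleftrightarrow>
     lead_coeff P = 1 \<and> irreducible P \<and> (\<exists>k\<ge>1. f = P ^ k)"

(* The base P is unique when it exists, see is_power_of_monic_irreducible_unique. *)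
definition mangoldt_poly :: "'a::finite_field poly \<Rightarrow> nat" where
  "mangoldt_poly f =
     (if \<exists>P. is_power_of_monic_irreducible f P
      then degree (THE P. is_power_of_monic_irreducible f P) else 0)"

definition psi_poly :: "nat \<Rightarrow> 'a::finite_field \<Rightarrow> 'a \<Rightarrow> 'a \<Rightarrow> nat" where
  "psi_poly n t1 t2 t3 =
     (\<Sum>f | f \<in> monic_polys n \<and> next_to_leading 1 f = t1 \<and>
            next_to_leading 2 f = t2 \<and> next_to_leading 3 f = t3. mangoldt_poly f)"

(* The sums above range over finite sets, so no sum is 0 by convention. *)
lemma finite_monic_polys: "finite (monic_polys n :: 'a::finite_field poly set)"
proof (rule finite_subset)
  have "finite {xs :: 'a list. set xs \<subseteq> UNIV \<and> length xs = Suc n}"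
    by (rule finite_lists_length_eq) simp
  then show "finite (Poly ` {xs :: 'a list. set xs \<subseteq> UNIV \<and> length xs = Suc n})"
    by (rule finite_imageI)
  show "(monic_polys n :: 'a poly set) \<subseteq> Poly ` {xs. set xs \<subseteq> UNIV \<and> length xs = Suc n}"
  proof
    fix f :: "'a poly"
    assume f: "f \<in> monic_polys n"
    then have "f \<noteq> 0" by (auto simp: monic_polys_def)
    with f have "length (coeffs f) = Suc n" "f = Poly (coeffs f)"
      by (auto simp: monic_polys_def length_coeffs_degree)
    then show "f \<in> Poly ` {xs. set xs \<subseteq> UNIV \<and> length xs = Suc n}" by blast
  qed
qed

lemma is_power_of_monic_irreducible_unique:
  assumes "is_power_of_monic_irreducible f P" "is_power_of_monic_irreducible f Q"
  shows "P = Q"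
proof -
  obtain k l where kl: "k \<ge> 1" "l \<ge> 1" "f = P ^ k" "f = Q ^ l"
    using assms by (auto simp: is_power_of_monic_irreducible_def)
  have irr: "irreducible P" "irreducible Q" and lc: "lead_coeff P = 1" "lead_coeff Q = 1"
    using assms by (auto simp: is_power_of_monic_irreducible_def)
  have "P dvd Q ^ l" using kl by (metis dvd_power less_le_trans zero_less_one)
  then have "P dvd Q"
    using prime_elem_dvd_power irr field_poly_irreducible_imp_prime by blast
  then obtain c where c: "Q = P * c" by blast
  with irr have "is_unit c" unfolding irreducible_def by blast
  then obtain a where a: "c = [:a:]" by (auto simp: is_unit_poly_iff)
  from c a lc have "a = 1" by (metis lead_coeff_mult lead_coeff_pCons(2) mult_1 pCons_0_0 lead_coeff_pCons(1) mult_zero_right zero_neq_one)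
  with c a show ?thesis by (simp add: one_pCons[symmetric])
qed

end

theory Submission
  imports Defs "HOL-Number_Theory.Cong" "HOL-Algebra.Coset" Complex_Main
begin

text \<open>The sum is evaluated by Fourier analysis on the first three next-to-leading coefficients.
  Read \<open>- t1\<close>, \<open>t1\<^sup>2 - 2 * t2\<close> and \<open>- t1 ^ 3 + 3 * t1 * t2 - 3 * t3\<close> as the first three power sums of
  the roots of \<open>f\<close>. They are additive in \<open>f\<close> under multiplication of monic polynomials, and as 2 and 3
  are invertible they determine the coefficients. So for a nontrivial additive character \<open>\<psi>\<close> of
  the field the functions \<open>chi c1 c2 c3\<close>, which apply \<open>\<psi>\<close> to a linear combination of the power sums,
  are multiplicative, and \<open>psi_poly_fourier\<close> recovers the wanted sum from the sums of \<open>\<Lambda> \<chi>\<close>.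

  The identity \<open>deg f = \<Sum> \<Lambda> d\<close>, over the monic divisors \<open>d\<close> of \<open>f\<close>, gives Newton's recurrence between the
  sums of \<open>\<chi>\<close> and those of \<open>\<Lambda> \<chi>\<close> (\<open>mangoldt_poly_convolution\<close>). If \<open>\<chi>\<close> is nontrivial then its sum over
  the monic polynomials of degree \<open>n\<close> vanishes for \<open>n \<ge> 3\<close>. Hence the sum of \<open>\<Lambda> \<chi>\<close> is
  \<open>- (\<alpha> ^ n + \<beta> ^ n)\<close>, where \<open>1 + a1 u + a2 u\<^sup>2 = (1 - \<alpha> u) (1 - \<beta> u)\<close> is the L-polynomial of \<open>\<chi>\<close>. What is
  needed is that every nonzero root has 60th power \<open>q ^ 30\<close>; there are two of them if \<open>c3 \<noteq> 0\<close>, one if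
  \<open>c3 = 0\<close> and \<open>c2 \<noteq> 0\<close>, and none if \<open>c3 = c2 = 0\<close>. A single nonzero root is a quadratic Gauss sum up to a
  fifth root of unity and a sign.

  For \<open>c3 \<noteq> 0\<close>, completing the cube reduces the claim to the sums \<open>A(c, a) = \<Sum> \<psi> (c x\<^sup>3 + a x)\<close>. Let
  \<open>B(c, a)\<close> be the same sum weighted by the quadratic character \<open>\<eta>\<close> and let \<open>G\<close> be the
  quadratic Gauss sum, so \<open>G\<^sup>2 = q\<close>. Two facts pin down \<open>A\<close> without any bound on its size.
  The substitution \<open>x = u + v\<close>, \<open>y = u - v\<close> in \<open>A(c, a)\<^sup>2\<close> leaves a quadratic Gauss sum in \<open>v\<close> and gives
  \<open>A(c, a)\<^sup>2 = q + \<eta>(c) G B(2c, 2a)\<close>. And \<open>A + B\<close> is the sum of \<open>\<psi> (c y\<^sup>6 + a y\<^sup>2)\<close>, while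
  \<open>A - B\<close> is the same sum with \<open>c g\<^sup>3\<close>, \<open>a g\<close> for \<open>c\<close>, \<open>a\<close>, where \<open>g\<close> is a nonsquare. The exponent is a
  quadratic form over the prime field because \<open>y\<^sup>6 = y y\<^sup>5\<close> and the characteristic is 5; so \<open>(A \<plusminus> B)\<^sup>2\<close> is \<open>q\<close> times
  the order of a radical, which is 1, 5 or 25. As \<open>B(4c, 4a) = B(- c, - a) = B(c, a)\<close>, these relations
  at \<open>(c, a)\<close> and \<open>(2c, 2a)\<close> close up, and elementary algebra
  (\<open>normalised_sum_values\<close>) leaves for \<open>A\<^sup>2 / q\<close> only the values 0, 1, 4 and the roots of
  \<open>X\<^sup>2 - 3 X + 1\<close>. Then \<open>\<alpha>\<close> divided by \<open>G\<close> and a fifth root of unity is a root of unity of order dividing 60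
  (\<open>root_of_unity_if_trace\<close>).\<close>

section \<open>A Frobenius-invariant additive character\<close>

lemma char_eq_5_if_card:
  assumes "CARD('a::finite_field) = 5 ^ r"
  shows "CHAR('a) = 5"
proof -
  \<comment> \<open>Translation by 1 permutes the field, so the number of elements is 0 in it.\<close>
  have "(\<Sum>x\<in>UNIV. x + 1 :: 'a) = (\<Sum>x\<in>UNIV. x)"
    by (rule sum.reindex_bij_witness[of _ "\<lambda>x. x - 1" "\<lambda>x. x + 1"]) auto
  then have "of_nat CARD('a) = (0 :: 'a)" by (simp add: sum.distrib)
  then have "CHAR('a) dvd 5 ^ r"
    using assms by (simp only: of_nat_eq_0_iff_char_dvd)
  moreover have "prime CHAR('a)" by simp
  ultimately have "CHAR('a) dvd 5" using prime_dvd_power by blast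
  then show ?thesis
    using \<open>prime CHAR('a)\<close> primes_dvd_imp_eq[of "CHAR('a)" 5] by simp
qed

lemma frobenius_fixed_imp_of_nat:
  fixes x :: "'a::finite_field"
  assumes "CHAR('a) = 5" and "x ^ 5 = x"
  shows "\<exists>n<5. x = of_nat n"
proof -
  define p :: "'a poly" where "p = monom 1 5 - monom 1 1"
  have coeff: "coeff p 5 = 1" by (simp add: p_def)
  have p: "p \<noteq> 0" using coeff by force
  have deg: "degree p \<le> 5" unfolding p_def
    by (intro degree_diff_le) (auto intro: order.trans[OF degree_monom_le])
  have roots: "poly p x = x ^ 5 - x" for x by (simp add: p_def poly_monom)
  have fin: "finite {x. poly p x = 0}" by (simp add: poly_roots_finite p)
  have inj: "inj_on (of_nat :: nat \<Rightarrow> 'a) {..<5}"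
    by (rule inj_onI) (auto simp: of_nat_eq_iff_cong_CHAR assms(1) cong_def)
  have sub: "(of_nat :: nat \<Rightarrow> 'a) ` {..<5} \<subseteq> {x. poly p x = 0}"
  proof safe
    fix n :: nat
    have "[n ^ 5 = n] (mod 5)" if "n < 5"
    proof -
      have "n = 0 \<or> n = 1 \<or> n = 2 \<or> n = 3 \<or> n = 4" using that by auto
      then show ?thesis by (auto simp: cong_def)
    qed
    moreover assume "n < 5"
    ultimately have "(of_nat (n ^ 5) :: 'a) = of_nat n"
      by (simp only: of_nat_eq_iff_cong_CHAR assms(1))
    then show "poly p (of_nat n) = 0" by (simp add: roots)
  qed
  have "(of_nat :: nat \<Rightarrow> 'a) ` {..<5} = {x. poly p x = 0}"
  proof (rule card_subset_eq[OF fin sub])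
    have "card ((of_nat :: nat \<Rightarrow> 'a) ` {..<5}) = 5" by (simp add: card_image inj)
    moreover have "card {x. poly p x = 0} \<le> 5"
      using card_poly_roots_bound[OF p] deg by linarith
    ultimately show "card ((of_nat :: nat \<Rightarrow> 'a) ` {..<5}) = card {x. poly p x = 0}"
      using card_mono[OF fin sub] by simp
  qed
  moreover have "x \<in> {x. poly p x = 0}" using assms(2) by (simp add: roots)
  ultimately show ?thesis by blast
qed

text \<open>The absolute trace to the prime field, for a field with \<open>5 ^ r\<close> elements.\<close>

definition abs_trace :: "nat \<Rightarrow> 'a::finite_field \<Rightarrow> 'a" where
  "abs_trace r x = (\<Sum>i<r. x ^ (5 ^ i))"

lemma abs_trace_add:
  assumes "CHAR('a::finite_field) = 5"
  shows "abs_trace r (x + y :: 'a) = abs_trace r x + abs_trace r y"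
proof -
  have "prime CHAR('a)" by simp
  then have "(x + y) ^ 5 ^ i = x ^ 5 ^ i + y ^ 5 ^ i" for i
    by (rule freshmans_dream') (simp add: assms)
  then show ?thesis by (simp add: abs_trace_def sum.distrib)
qed

lemma abs_trace_frobenius:
  assumes "CARD('a::finite_field) = 5 ^ r"
  shows "abs_trace r (x ^ 5 :: 'a) = abs_trace r x"
proof -
  have "abs_trace r (x ^ 5) = (\<Sum>i<r. x ^ (5 ^ Suc i))"
    by (simp add: abs_trace_def flip: power_mult)
  also have "\<dots> + x ^ 5 ^ 0 = (\<Sum>i<Suc r. x ^ (5 ^ i))"
    by (subst sum.lessThan_Suc_shift) (simp add: add_ac)
  also have "\<dots> = abs_trace r x + x"
    using finite_field_power_card_eq_same[of x] by (simp add: abs_trace_def assms)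
  finally show ?thesis by simp
qed

lemma abs_trace_power_5:
  assumes "CARD('a::finite_field) = 5 ^ r" and "CHAR('a) = 5"
  shows "abs_trace r (x :: 'a) ^ 5 = abs_trace r x"
proof -
  have "prime CHAR('a)" by simp
  then have "abs_trace r x ^ 5 = (\<Sum>i<r. (x ^ (5 ^ i)) ^ 5)"
    unfolding abs_trace_def by (rule freshmans_dream_sum) (simp add: assms)
  also have "\<dots> = abs_trace r (x ^ 5)"
    by (simp add: abs_trace_def mult.commute flip: power_mult)
  finally show ?thesis using abs_trace_frobenius[OF assms(1)] by simp
qed

lemma abs_trace_nonzero:
  assumes "CARD('a::finite_field) = 5 ^ r"
  shows "\<exists>x::'a. abs_trace r x \<noteq> 0"
proof (rule ccontr)
  assume *: "\<not> ?thesis"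
  have "CARD('a) \<noteq> 1" using finite_field_class.axioms card_1_singletonE[of "UNIV::'a set"]
    by (metis UNIV_I singletonD zero_neq_one)
  then have r: "r > 0" using assms by (cases r) auto
  define p :: "'a poly" where "p = (\<Sum>i<r. monom 1 (5 ^ i))"
  have "coeff p (5 ^ (r - 1)) = (\<Sum>i<r. if i = r - 1 then 1 else 0)"
    unfolding p_def coeff_sum by (intro sum.cong) auto
  also have "\<dots> = 1" using r by simp
  finally have "coeff p (5 ^ (r - 1)) = 1" .
  then have p: "p \<noteq> 0" by force
  have "degree p \<le> 5 ^ (r - 1)" unfolding p_def
    by (intro degree_sum_le) (auto intro!: order.trans[OF degree_monom_le] power_increasing)
  moreover have "{x. poly p x = 0} = UNIV"
    using * by (auto simp: p_def poly_sum poly_monom abs_trace_def)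
  ultimately have "5 ^ r \<le> (5 :: nat) ^ (r - 1)"
    using card_poly_roots_bound[OF p] assms by (metis order.trans)
  then show False using r by simp
qed

text \<open>The character is \<open>\<omega> ^ tr x\<close>, with \<open>tr\<close> the absolute trace, read as a natural number, and \<open>\<omega>\<close> a
  primitive fifth root of unity.\<close>

theorem exists_frobenius_invariant_character:
  assumes "CARD('a::finite_field) = 5 ^ r" and "CHAR('a) = 5"
  shows "\<exists>\<psi> :: 'a \<Rightarrow> complex.
    \<psi> 0 = 1 \<and> (\<forall>x y. \<psi> (x + y) = \<psi> x * \<psi> y) \<and> (\<exists>x. \<psi> x \<noteq> 1) \<and> (\<forall>x. \<psi> (x ^ 5) = \<psi> x)"
proof -
  obtain d :: "'a \<Rightarrow> nat" where d: "\<And>x. abs_trace r x = of_nat (d x)"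
    using frobenius_fixed_imp_of_nat[OF assms(2) abs_trace_power_5[OF assms]] by metis
  have "card {z::complex. z ^ 5 = 1} = 5" by (rule card_roots_unity_eq) simp
  then have "\<not> {z::complex. z ^ 5 = 1} \<subseteq> {1}" using card_mono[of "{1::complex}" "{z. z ^ 5 = 1}"] by force
  then obtain \<omega> :: complex where \<omega>5: "\<omega> ^ 5 = 1" and "\<omega> \<noteq> 1" by blast
  have \<omega>1: "5 dvd n" if "\<omega> ^ n = 1" for n
  proof (rule ccontr)
    assume "\<not> 5 dvd n"
    then have "coprime n 5" using prime_imp_coprime[of 5 n] by (simp add: coprime_commute)
    then obtain m where "[n * m = 1] (mod 5)" using cong_solve_coprime_nat by auto
    then have "n * m = 5 * (n * m div 5) + 1"
      using mult_div_mod_eq[of 5 "n * m"] by (simp add: cong_def)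
    then have "\<omega> ^ (n * m) = (\<omega> ^ 5) ^ (n * m div 5) * \<omega>" by (metis power_add power_mult power_one_right)
    then show False using that \<omega>5 \<open>\<omega> \<noteq> 1\<close> by (simp add: power_mult)
  qed
  have \<omega>_cong: "\<omega> ^ m = \<omega> ^ n" if "[m = n] (mod 5)" for m n
  proof -
    have "\<omega> ^ m = \<omega> ^ (5 * (m div 5) + m mod 5)" for m by simp
    then have "\<omega> ^ m = \<omega> ^ (m mod 5)" for m
      by (metis \<omega>5 mult_1 power_add power_mult power_one)
    then show ?thesis using that by (metis cong_def)
  qed
  define \<psi> where "\<psi> x = \<omega> ^ d x" for x
  have add: "\<psi> (x + y) = \<psi> x * \<psi> y" for x y
  proof -
    have "(of_nat (d (x + y)) :: 'a) = of_nat (d x + d y)"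
      by (simp add: abs_trace_add[OF assms(2)] flip: d)
    then have "[d (x + y) = d x + d y] (mod 5)"
      by (simp only: of_nat_eq_iff_cong_CHAR assms(2))
    then show ?thesis by (simp add: \<psi>_def \<omega>_cong flip: power_add)
  qed
  have "\<omega> \<noteq> 0" using \<omega>5 by auto
  then have "\<psi> 0 = 1" using add[of 0 0] by (simp add: \<psi>_def)
  moreover note add
  moreover have "\<psi> (x ^ 5) = \<psi> x" for x
  proof -
    have "(of_nat (d (x ^ 5)) :: 'a) = of_nat (d x)"
      by (simp add: abs_trace_frobenius[OF assms(1)] flip: d)
    then have "[d (x ^ 5) = d x] (mod 5)"
      by (simp only: of_nat_eq_iff_cong_CHAR assms(2))
    then show ?thesis by (simp add: \<psi>_def \<omega>_cong)
  qed
  moreover obtain x :: 'a where "abs_trace r x \<noteq> 0" using abs_trace_nonzero[OF assms(1)] by blast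
  then have "\<not> 5 dvd d x" using d by (metis of_nat_eq_0_iff_char_dvd assms(2))
  then have "\<psi> x \<noteq> 1" using \<omega>1 by (auto simp: \<psi>_def)
  ultimately show ?thesis by blast
qed

section \<open>Cubic exponential sums in characteristic five\<close>

text \<open>A nontrivial additive character of a field with \<open>5 ^ r\<close> elements that is invariant under the
  Frobenius map. The condition \<open>\<psi> 0 = 1\<close> excludes the zero function.\<close>

locale frobenius_invariant_character =
  fixes \<psi> :: "'a::finite_field \<Rightarrow> complex" and r :: nat
  assumes card_field: "CARD('a) = 5 ^ r"
    and \<psi>_0: "\<psi> 0 = 1"
    and \<psi>_add: "\<psi> (x + y) = \<psi> x * \<psi> y"
    and \<psi>_nontrivial: "\<exists>x. \<psi> x \<noteq> 1"
    and \<psi>_frobenius: "\<psi> (x ^ 5) = \<psi> x"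
begin

text \<open>The number of elements of the field, as a complex number.\<close>

abbreviation q :: complex where "q \<equiv> 5 ^ r"

lemma char5: "CHAR('a) = 5"
  using card_field by (rule char_eq_5_if_card)

lemma five [simp]: "(5 :: 'a) = 0"
  using of_nat_CHAR[where ?'a = 'a] by (simp add: char5)

lemma two_neq_0 [simp]: "(2 :: 'a) \<noteq> 0"
proof
  assume "(2 :: 'a) = 0"
  moreover have "(5 :: 'a) = 2 * 2 + 1" by simp
  ultimately show False by simp
qed

lemma three_eq: "(3 :: 'a) = - 2"
proof -
  have "(3 :: 'a) + 2 = 5" by simp
  then show ?thesis by (simp only: five eq_neg_iff_add_eq_0)
qed

lemma three_neq_0 [simp]: "(3 :: 'a) \<noteq> 0"
  by (simp add: three_eq)

lemma four_eq: "(4 :: 'a) = - 1"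
proof -
  have "(4 :: 'a) + 1 = 5" by simp
  then show ?thesis by (simp only: five eq_neg_iff_add_eq_0)
qed

lemma six_eq: "(6 :: 'a) = 1"
proof -
  have "(6 :: 'a) = 5 + 1" by (simp del: five)
  then show ?thesis by (simp only: five) simp
qed

lemma q_neq_0: "q \<noteq> 0"
  by (simp add: card_field)

lemma \<psi>_of_nat: "\<psi> (of_nat n * x) = \<psi> x ^ n"
  by (induction n) (simp_all add: \<psi>_0 \<psi>_add distrib_right)

lemma \<psi>_power_5: "\<psi> x ^ 5 = 1"
  using \<psi>_of_nat[of 5 x] by (simp add: \<psi>_0)

lemma sum_\<psi>: "(\<Sum>x\<in>UNIV. \<psi> x) = 0"
proof -
  obtain a where a: "\<psi> a \<noteq> 1" using \<psi>_nontrivial by blast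
  have "(\<Sum>x\<in>UNIV. \<psi> x) = (\<Sum>x\<in>UNIV. \<psi> (a + x))"
    by (rule sum.reindex_bij_witness[of _ "\<lambda>x. a + x" "\<lambda>x. x - a"]) auto
  also have "\<dots> = \<psi> a * (\<Sum>x\<in>UNIV. \<psi> x)" by (simp add: \<psi>_add sum_distrib_left)
  finally show ?thesis using a by simp
qed

lemma sum_\<psi>_mult: "(\<Sum>x\<in>UNIV. \<psi> (k * x)) = q * of_bool (k = 0)"
proof (cases "k = 0")
  case False
  have "(\<Sum>x\<in>UNIV. \<psi> (k * x)) = (\<Sum>x\<in>UNIV. \<psi> x)"
    by (rule sum.reindex_bij_witness[of _ "\<lambda>x. x / k" "\<lambda>x. k * x"]) (use False in auto)
  then show ?thesis using False by (simp add: sum_\<psi>)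
qed (simp add: \<psi>_0 card_field)

text \<open>The quadratic character of the field, with value 0 at 0.\<close>

definition eta :: "'a \<Rightarrow> complex" where
  "eta x = (if x = 0 then 0 else if \<exists>y. x = y\<^sup>2 then 1 else - 1)"

lemma eta_square: "y \<noteq> 0 \<Longrightarrow> eta (y\<^sup>2) = 1"
  by (auto simp: eta_def)

lemma eta_cases: "x \<noteq> 0 \<Longrightarrow> eta x = 1 \<or> eta x = - 1"
  by (auto simp: eta_def)

lemma eta_sq: "x \<noteq> 0 \<Longrightarrow> eta x * eta x = 1"
  by (auto simp: eta_def)

lemma neq_uminus: "(y :: 'a) \<noteq> 0 \<Longrightarrow> y \<noteq> - y"
proof
  assume y: "y \<noteq> 0" "y = - y"
  have "2 * y = y + y" by simp
  also have "\<dots> = 0" using y(2) by (metis add.right_inverse)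
  finally show False using y(1) by simp
qed

lemma card_sqrts: "of_nat (card {y. y\<^sup>2 = x}) = 1 + eta x"
proof -
  consider "x = 0" | y where "x = y\<^sup>2" "y \<noteq> 0" | "x \<noteq> 0" "\<nexists>y. x = y\<^sup>2"
    by (metis zero_power2)
  then show ?thesis
  proof cases
    case (2 y)
    then have "{z. z\<^sup>2 = x} = {y, - y}" by (auto simp: power2_eq_iff)
    then show ?thesis using 2 neq_uminus[of y] by (simp add: eta_square)
  next
    case 3
    then have "{z. z\<^sup>2 = x} = {}" by auto
    then show ?thesis using 3 by (auto simp: eta_def)
  qed (auto simp: eta_def)
qed

lemma sum_over_squares:
  "(\<Sum>y\<in>UNIV. F (y\<^sup>2)) = (\<Sum>x\<in>UNIV. (1 + eta x) * F x)" for F :: "'a \<Rightarrow> complex"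
proof -
  have "(\<Sum>y\<in>UNIV. F (y\<^sup>2)) = (\<Sum>x\<in>UNIV. \<Sum>y | y \<in> UNIV \<and> y\<^sup>2 = x. F (y\<^sup>2))"
    by (rule sum.group[symmetric]) auto
  also have "\<dots> = (\<Sum>x\<in>UNIV. (1 + eta x) * F x)"
    by (intro sum.cong) (auto simp flip: card_sqrts)
  finally show ?thesis .
qed

lemma sum_eta: "(\<Sum>x\<in>UNIV. eta x) = 0"
  using sum_over_squares[of "\<lambda>_. 1"] by (simp add: sum.distrib)

text \<open>The nontrivial case is a nonsquare factor \<open>g\<close>. Since nonzero squares times \<open>g\<close> are nonsquares,
  \<open>eta (g * z) + eta z\<close> is never positive; its sum over all \<open>z\<close> is 0, so it vanishes identically.\<close>

lemma eta_mult: "eta (x * y) = eta x * eta y"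
proof -
  have sq: "eta (g\<^sup>2 * y) = eta y" if "g \<noteq> 0" for g y
  proof -
    have "(\<exists>z. g\<^sup>2 * y = z\<^sup>2) \<longleftrightarrow> (\<exists>z. y = z\<^sup>2)"
    proof
      assume "\<exists>z. g\<^sup>2 * y = z\<^sup>2"
      then obtain z where "g\<^sup>2 * y = z\<^sup>2" by blast
      then have "y = (z / g)\<^sup>2" using that by (simp add: field_simps)
      then show "\<exists>z. y = z\<^sup>2" by blast
    qed (metis power_mult_distrib)
    then show ?thesis using that by (simp add: eta_def)
  qed
  have ns: "eta (g * y) = - eta y" if g: "eta g = - 1" for g y
  proof (rule ccontr)
    assume *: "eta (g * y) \<noteq> - eta y"
    have g0: "g \<noteq> 0" using g by (auto simp: eta_def)
    have le: "Re (eta (g * z) + eta z) \<le> 0" for z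
    proof (cases "\<exists>w. z = w\<^sup>2")
      case True
      then obtain w where w: "z = w\<^sup>2" by blast
      show ?thesis
      proof (cases "w = 0")
        case False
        then have "eta (g * z) = - 1" using sq[of w g] g w by (simp add: mult.commute)
        then show ?thesis using w False by (simp add: eta_square)
      qed (simp add: w eta_def)
    qed (auto simp: eta_def)
    have "(\<Sum>z\<in>UNIV. eta (g * z)) = (\<Sum>z\<in>UNIV. eta z)"
      by (rule sum.reindex_bij_witness[of _ "\<lambda>x. x / g" "\<lambda>x. g * x"]) (use g0 in auto)
    then have "(\<Sum>z\<in>UNIV. eta (g * z) + eta z) = 0" by (simp add: sum.distrib sum_eta)
    then have "(\<Sum>z\<in>UNIV. - Re (eta (g * z) + eta z)) = 0"
      by (simp add: Re_sum[symmetric] sum_negf del: Re_sum plus_complex.sel)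
    then have "- Re (eta (g * y) + eta y) = 0"
      using sum_nonneg_0[of UNIV "\<lambda>z. - Re (eta (g * z) + eta z)" y] le
      by (simp del: plus_complex.sel)
    then show False using * by (auto simp: eta_def split: if_splits)
  qed
  show ?thesis
  proof (cases "x = 0")
    case False
    then show ?thesis
    proof (cases "\<exists>g. x = g\<^sup>2")
      case True
      then show ?thesis using sq[of _ y] False by (auto simp: eta_square)
    next
      case False
      then show ?thesis using ns[of x y] \<open>x \<noteq> 0\<close> by (simp add: eta_def)
    qed
  qed (simp add: eta_def)
qed

lemma eta_uminus: "eta (- x) = eta x"
proof -
  have "(- x) = 2\<^sup>2 * x" by (simp add: four_eq)
  then show ?thesis by (simp only: eta_mult eta_square[OF two_neq_0]) simp
qed

lemma ex_nonsquare: "\<exists>g. eta g = - 1"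
proof (rule ccontr)
  assume *: "\<nexists>g. eta g = - 1"
  then have "eta x = of_bool (x \<noteq> 0)" for x
    using eta_cases[of x] by (cases "x = 0") (auto simp: eta_def[of 0])
  then have "(\<Sum>x\<in>UNIV. eta x) = of_nat (card {x :: 'a. x \<noteq> 0})" by simp
  then have "card {x :: 'a. x \<noteq> 0} = 0" using sum_eta by simp
  then have "(1 :: 'a) = 0" by (metis (mono_tags) card_0_eq empty_iff finite mem_Collect_eq)
  then show False by simp
qed

text \<open>The quadratic Gauss sum.\<close>

definition gauss :: complex where "gauss = (\<Sum>x\<in>UNIV. \<psi> (x\<^sup>2))"

lemma gauss_sum:
  assumes "k \<noteq> 0"
  shows "(\<Sum>x\<in>UNIV. \<psi> (k * x\<^sup>2)) = eta k * gauss"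
proof -
  have *: "(\<Sum>x\<in>UNIV. \<psi> (k * x\<^sup>2)) = eta k * (\<Sum>x\<in>UNIV. eta x * \<psi> x)" if "k \<noteq> 0" for k
  proof -
    have "(\<Sum>x\<in>UNIV. \<psi> (k * x\<^sup>2)) = (\<Sum>x\<in>UNIV. \<psi> (k * x) + eta x * \<psi> (k * x))"
      by (simp add: sum_over_squares[of "\<lambda>x. \<psi> (k * x)"] distrib_right)
    also have "\<dots> = (\<Sum>x\<in>UNIV. eta x * \<psi> (k * x))"
      using that by (simp add: sum.distrib sum_\<psi>_mult)
    also have "\<dots> = (\<Sum>x\<in>UNIV. eta k * (eta x * \<psi> x))"
      by (rule sum.reindex_bij_witness[of _ "\<lambda>x. x / k" "\<lambda>x. k * x"])
        (use that eta_sq[of k] in \<open>auto simp: eta_mult mult_ac\<close>)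
    finally show ?thesis by (simp add: sum_distrib_left)
  qed
  from *[of 1] have "gauss = (\<Sum>x\<in>UNIV. eta x * \<psi> x)"
    using eta_square[of 1] by (simp add: gauss_def)
  then show ?thesis using *[OF assms] by simp
qed

lemma sum_sum_shift:
  "(\<Sum>x\<in>UNIV. \<Sum>y\<in>UNIV. F x y) = (\<Sum>u\<in>UNIV. \<Sum>v\<in>UNIV. F (u + v) (u - v))"
  for F :: "'a \<Rightarrow> 'a \<Rightarrow> complex"
  unfolding sum.cartesian_product UNIV_Times_UNIV
  by (rule sum.reindex_bij_witness[of _ "\<lambda>(u, v). (u + v, u - v)" "\<lambda>(x, y). ((x + y) / 2, (x - y) / 2)"])
    (auto simp: field_simps four_eq)

text \<open>As -1 is the square of 2, the square of the sum is the sum of \<open>\<psi> (x\<^sup>2 - y\<^sup>2)\<close>, which factors as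
  \<open>\<psi> ((x + y) * (x - y))\<close>.\<close>

lemma gauss_squared: "gauss\<^sup>2 = q"
proof -
  have "gauss = (\<Sum>y\<in>UNIV. \<psi> ((2 * y)\<^sup>2))" unfolding gauss_def
    by (rule sum.reindex_bij_witness[of _ "\<lambda>x. 2 * x" "\<lambda>x. x / 2"]) auto
  then have "gauss\<^sup>2 = (\<Sum>x\<in>UNIV. \<psi> (x\<^sup>2)) * (\<Sum>y\<in>UNIV. \<psi> (- y\<^sup>2))"
    by (simp add: power_mult_distrib four_eq) (simp add: gauss_def power2_eq_square)
  also have "\<dots> = (\<Sum>x\<in>UNIV. \<Sum>y\<in>UNIV. \<psi> (x\<^sup>2 + - y\<^sup>2))"
    by (simp only: sum_product \<psi>_add)
  also have "\<dots> = (\<Sum>u\<in>UNIV. \<Sum>v\<in>UNIV. \<psi> ((4 * u) * v))"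
    by (subst sum_sum_shift) (simp add: power2_eq_square algebra_simps)
  also have "\<dots> = q" by (simp only: sum_\<psi>_mult) (simp add: four_eq)
  finally show ?thesis .
qed

lemma gauss_neq_0: "gauss \<noteq> 0"
  using gauss_squared q_neq_0 by force

text \<open>The cubic sums, their twists by the quadratic character, and the sextic sums obtained from them
  by putting a square for the variable. The latter have a quadratic form over the prime field in
  the exponent.\<close>

definition cubic_sum :: "'a \<Rightarrow> 'a \<Rightarrow> complex" where
  "cubic_sum c a = (\<Sum>x\<in>UNIV. \<psi> (c * x ^ 3 + a * x))"

definition twisted_sum :: "'a \<Rightarrow> 'a \<Rightarrow> complex" where
  "twisted_sum c a = (\<Sum>x\<in>UNIV. eta x * \<psi> (c * x ^ 3 + a * x))"

definition sextic_sum :: "'a \<Rightarrow> 'a \<Rightarrow> complex" where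
  "sextic_sum c a = (\<Sum>y\<in>UNIV. \<psi> (c * y ^ 6 + a * y\<^sup>2))"

lemma twisted_sum_uminus: "twisted_sum (- c) (- a) = twisted_sum c a"
  unfolding twisted_sum_def
  by (rule sum.reindex_bij_witness[of _ uminus uminus]) (simp_all add: eta_uminus)

text \<open>The sum over \<open>v\<close> of \<open>\<psi> (6 * c * u * v\<^sup>2)\<close> is \<open>q\<close> for \<open>u = 0\<close> and a quadratic Gauss sum otherwise; the
  latter contributes the factor \<open>eta u\<close> that turns the sum over \<open>u\<close> into the twisted cubic sum.\<close>

lemma cubic_sum_squared:
  assumes "c \<noteq> 0"
  shows "(cubic_sum c a)\<^sup>2 = q + eta c * gauss * twisted_sum (2 * c) (2 * a)"
proof -
  have "(cubic_sum c a)\<^sup>2 = (\<Sum>x\<in>UNIV. \<Sum>y\<in>UNIV. \<psi> (c * (x ^ 3 + y ^ 3) + a * (x + y)))"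
    by (simp add: cubic_sum_def power2_eq_square sum_product algebra_simps flip: \<psi>_add)
  also have "\<dots> = (\<Sum>u\<in>UNIV. \<Sum>v\<in>UNIV. \<psi> (2 * c * u ^ 3 + 2 * a * u + (c * u) * v\<^sup>2))"
  proof (subst sum_sum_shift, intro sum.cong refl arg_cong[of _ _ \<psi>])
    fix u v :: 'a
    have "c * ((u + v) ^ 3 + (u - v) ^ 3) + a * (u + v + (u - v))
        = 2 * c * u ^ 3 + 2 * a * u + 6 * (c * u * v\<^sup>2)"
      by (simp add: power3_eq_cube power2_eq_square algebra_simps)
    then show "c * ((u + v) ^ 3 + (u - v) ^ 3) + a * (u + v + (u - v))
        = 2 * c * u ^ 3 + 2 * a * u + (c * u) * v\<^sup>2"
      by (simp add: six_eq)
  qed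
  also have "\<dots> = (\<Sum>u\<in>UNIV. \<psi> (2 * c * u ^ 3 + 2 * a * u) * (\<Sum>v\<in>UNIV. \<psi> ((c * u) * v\<^sup>2)))"
    by (simp add: \<psi>_add[of _ "_ * _\<^sup>2"] sum_distrib_left)
  also have "\<dots> = (\<Sum>u\<in>UNIV. q * of_bool (u = 0)
      + eta c * gauss * (eta u * \<psi> (2 * c * u ^ 3 + 2 * a * u)))"
  proof (intro sum.cong refl)
    fix u
    show "\<psi> (2 * c * u ^ 3 + 2 * a * u) * (\<Sum>v\<in>UNIV. \<psi> ((c * u) * v\<^sup>2))
      = q * of_bool (u = 0) + eta c * gauss * (eta u * \<psi> (2 * c * u ^ 3 + 2 * a * u))"
    proof (cases "u = 0")
      case False
      then show ?thesis using assms by (subst gauss_sum) (auto simp: eta_mult)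
    qed (simp add: \<psi>_0 eta_def card_field)
  qed
  also have "\<dots> = q + eta c * gauss * twisted_sum (2 * c) (2 * a)"
    by (simp add: sum.distrib twisted_sum_def sum_distrib_left)
  finally show ?thesis .
qed

lemma sextic_sum_eq: "sextic_sum c a = cubic_sum c a + twisted_sum c a"
proof -
  have "sextic_sum c a = (\<Sum>y\<in>UNIV. \<psi> (c * (y\<^sup>2) ^ 3 + a * y\<^sup>2))"
    by (simp add: sextic_sum_def flip: power_mult)
  also have "\<dots> = cubic_sum c a + twisted_sum c a"
    by (subst sum_over_squares[of "\<lambda>x. \<psi> (c * x ^ 3 + a * x)"])
      (simp add: cubic_sum_def twisted_sum_def distrib_right sum.distrib)
  finally show ?thesis .
qed

lemma sextic_sum_twist:
  assumes "eta g = - 1"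
  shows "sextic_sum (c * g ^ 3) (a * g) = cubic_sum c a - twisted_sum c a"
proof -
  have g: "g \<noteq> 0" using assms by (auto simp: eta_def)
  have "sextic_sum (c * g ^ 3) (a * g) = (\<Sum>x\<in>UNIV. (1 + eta x) * \<psi> (c * (g * x) ^ 3 + a * (g * x)))"
    by (subst sum_over_squares[of "\<lambda>x. \<psi> (c * (g * x) ^ 3 + a * (g * x))", symmetric])
      (simp add: sextic_sum_def power_mult_distrib mult_ac flip: power_mult)
  also have "\<dots> = (\<Sum>x\<in>UNIV. (1 - eta x) * \<psi> (c * x ^ 3 + a * x))"
    by (rule sum.reindex_bij_witness[of _ "\<lambda>x. x / g" "\<lambda>x. g * x"])
      (use g assms in \<open>auto simp: eta_mult\<close>)
  finally show ?thesis by (simp add: cubic_sum_def twisted_sum_def left_diff_distrib sum_subtractf)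
qed

text \<open>The radical of the quadratic form \<open>y \<mapsto> tr (c * y ^ 6 + a * y\<^sup>2)\<close> over the prime field, where \<open>tr\<close> is
  the absolute trace: the roots of an additive polynomial of degree 25.\<close>

definition radical :: "'a \<Rightarrow> 'a \<Rightarrow> 'a set" where
  "radical c a = {w. c ^ 5 * w ^ 25 + 2 * a ^ 5 * w ^ 5 + c * w = 0}"

lemma frobenius_add: "(x + y :: 'a) ^ 5 = x ^ 5 + y ^ 5"
  by (rule freshmans_dream) (simp_all add: char5)

lemma inj_frobenius: "inj (\<lambda>x::'a. x ^ 5)"
proof (rule injI)
  fix x y :: 'a assume "x ^ 5 = y ^ 5"
  then have "(x - y) ^ 5 = 0" using frobenius_add[of "x - y" y] by simp
  then show "x = y" by simp
qed

lemma bij_frobenius: "bij (\<lambda>x::'a. x ^ 5)"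
  using inj_frobenius finite_UNIV_inj_surj[of "\<lambda>x::'a. x ^ 5"] by (simp add: bij_def)

lemma two_power_5: "(2 :: 'a) ^ 5 = 2"
proof -
  have "(2 :: 'a) ^ 5 = 6 * 5 + 2" by (simp del: five)
  then show ?thesis by (simp only: five) simp
qed

text \<open>The usual evaluation of the squared modulus of a quadratic exponential sum. No complex
  conjugation is needed, since \<open>2 ^ 6 = 2\<^sup>2 = - 1\<close> makes the sum invariant under a change of sign of the form.\<close>

lemma sextic_sum_squared: "(sextic_sum c a)\<^sup>2 = q * of_nat (card (radical c a))"
proof -
  define Q where "Q y = c * y ^ 6 + a * y\<^sup>2" for y
  define L where "L w = c ^ 5 * w ^ 25 + 2 * a ^ 5 * w ^ 5 + c * w" for w
  \<comment> \<open>Frobenius invariance moves all of the bilinear form onto \<open>z ^ 5\<close>.\<close>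
  have polar: "\<psi> (Q (z + w) + - Q z) = \<psi> (Q w) * \<psi> (L w * z ^ 5)" for z w
  proof -
    have "Q (z + w) + - Q z = Q w + (c * z * w ^ 5 + c * w * z ^ 5 + 2 * a * z * w)"
      using frobenius_add[of z w] by (simp add: Q_def power_Suc numeral_eq_Suc algebra_simps)
    moreover have "\<psi> (c * z * w ^ 5) = \<psi> (c ^ 5 * w ^ 25 * z ^ 5)"
      by (subst \<psi>_frobenius[symmetric]) (simp add: power_mult_distrib mult_ac flip: power_mult)
    moreover have "\<psi> (2 * a * z * w) = \<psi> (2 * a ^ 5 * w ^ 5 * z ^ 5)"
      by (subst \<psi>_frobenius[symmetric]) (simp only: power_mult_distrib two_power_5 mult_ac)
    ultimately show ?thesis by (simp add: \<psi>_add L_def distrib_right distrib_left mult_ac)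
  qed
  have Q2: "Q (z + z) = - Q z" for z
  proof -
    have "(2 :: 'a) ^ 6 = 13 * 5 - 1" by (simp del: five)
    then have "(2 :: 'a) ^ 6 = - 1" by (simp only: five) simp
    then show ?thesis by (simp only: Q_def power_mult_distrib flip: mult_2) (simp add: four_eq)
  qed
  have "sextic_sum c a = (\<Sum>z\<in>UNIV. \<psi> (Q (2 * z)))" unfolding sextic_sum_def Q_def
    by (rule sum.reindex_bij_witness[of _ "\<lambda>x. 2 * x" "\<lambda>x. x / 2"]) auto
  also have "\<dots> = (\<Sum>z\<in>UNIV. \<psi> (- Q z))"
    by (simp only: mult_2 Q2)
  finally have "sextic_sum c a = (\<Sum>z\<in>UNIV. \<psi> (- Q z))" .
  moreover have "sextic_sum c a = (\<Sum>y\<in>UNIV. \<psi> (Q y))" by (simp only: sextic_sum_def Q_def)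
  ultimately have "(sextic_sum c a)\<^sup>2 = (\<Sum>z\<in>UNIV. \<psi> (- Q z)) * (\<Sum>y\<in>UNIV. \<psi> (Q y))"
    by (simp only: power2_eq_square)
  also have "\<dots> = (\<Sum>z\<in>UNIV. \<Sum>y\<in>UNIV. \<psi> (Q y + - Q z))"
    unfolding sum_product by (intro sum.cong refl) (simp only: \<psi>_add mult.commute)
  also have "\<dots> = (\<Sum>z\<in>UNIV. \<Sum>w\<in>UNIV. \<psi> (Q (z + w) + - Q z))"
  proof (rule sum.cong[OF refl])
    fix z
    show "(\<Sum>y\<in>UNIV. \<psi> (Q y + - Q z)) = (\<Sum>w\<in>UNIV. \<psi> (Q (z + w) + - Q z))"
      by (rule sum.reindex_bij_witness[of _ "\<lambda>w. z + w" "\<lambda>y. y - z"]) auto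
  qed
  also have "\<dots> = (\<Sum>w\<in>UNIV. \<Sum>z\<in>UNIV. \<psi> (Q w) * \<psi> (L w * z ^ 5))"
    unfolding polar by (rule sum.swap)
  also have "\<dots> = (\<Sum>w\<in>UNIV. \<psi> (Q w) * (q * of_bool (L w = 0)))"
    using sum.reindex_bij_betw[OF bij_frobenius, of "\<lambda>z. \<psi> (_ * z)"]
    by (simp add: sum_\<psi>_mult flip: sum_distrib_left)
  also have "\<dots> = (\<Sum>w\<in>UNIV. q * of_bool (L w = 0))"
  proof (intro sum.cong refl)
    fix w
    \<comment> \<open>The form vanishes on its radical: the value of \<open>\<psi>\<close> is both a cube root and a fifth root of 1.\<close>
    have "\<psi> (Q w) = 1" if "L w = 0"
    proof -
      have "\<psi> (- Q w + - Q w) = \<psi> (Q w)"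
        using polar[of w w] that Q2[of w] by (simp add: \<psi>_0)
      moreover have "\<psi> (Q w) * \<psi> (- Q w) = 1"
        by (simp add: \<psi>_0 flip: \<psi>_add)
      moreover have "\<psi> (Q w) * \<psi> (Q w) * (\<psi> (- Q w) * \<psi> (- Q w))
          = (\<psi> (Q w) * \<psi> (- Q w)) * (\<psi> (Q w) * \<psi> (- Q w))"
        by (simp only: mult_ac)
      ultimately have "\<psi> (Q w) ^ 3 = 1" by (simp only: \<psi>_add power3_eq_cube mult_1_left)
      then have "\<psi> (Q w) ^ 5 = \<psi> (Q w) ^ 2" by (simp add: power_numeral_reduce)
      then have "\<psi> (Q w) ^ 2 = 1" by (simp add: \<psi>_power_5)
      then show ?thesis using \<open>\<psi> (Q w) ^ 3 = 1\<close> by (simp add: power_numeral_reduce)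
    qed
    then show "\<psi> (Q w) * (q * of_bool (L w = 0)) = q * of_bool (L w = 0)" by auto
  qed
  also have "\<dots> = q * of_nat (card (radical c a))"
    by (simp add: radical_def L_def flip: sum_distrib_left)
  finally show ?thesis .
qed

text \<open>The radical is a subgroup of the additive group, so its order divides \<open>5 ^ r\<close>; as a set of roots it has at most 25
  elements.\<close>

lemma card_radical:
  assumes "c \<noteq> 0"
  shows "card (radical c a) \<in> {1, 5, 25}"
proof -
  define p :: "'a poly" where "p = monom (c ^ 5) 25 + monom (2 * a ^ 5) 5 + monom c 1"
  have "coeff p 1 = c" by (simp add: p_def)
  then have p: "p \<noteq> 0" using assms by force
  have "degree p \<le> 25" unfolding p_def
    by (intro degree_add_le) (auto intro: order.trans[OF degree_monom_le])
  moreover have "{x. poly p x = 0} = radical c a"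
    by (simp add: p_def radical_def poly_monom)
  ultimately have le: "card (radical c a) \<le> 25"
    using card_poly_roots_bound[OF p] by simp
  define M :: "'a monoid" where "M = \<lparr>carrier = UNIV, mult = (+), one = 0\<rparr>"
  have M: "group M"
    by (rule groupI) (auto simp: M_def add.assoc intro: exI[of _ "- _"])
  have sub: "subgroup (radical c a) M"
  proof (rule group.subgroupI[OF M])
    show "radical c a \<noteq> {}" by (auto simp: radical_def intro: exI[of _ 0])
    fix x assume x: "x \<in> radical c a"
    have "inv\<^bsub>M\<^esub> x = - x" by (rule group.inv_equality[OF M]) (simp_all add: M_def)
    moreover have "- x \<in> radical c a"
      using x by (simp add: radical_def) algebra
    ultimately show "inv\<^bsub>M\<^esub> x \<in> radical c a" by simp
    fix y assume y: "y \<in> radical c a"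
    have "(x + y) ^ 25 = x ^ 25 + y ^ 25"
      using frobenius_add[of "x ^ 5" "y ^ 5"] power_mult[of "x + y" 5 5]
      by (simp add: frobenius_add flip: power_mult)
    then have "c ^ 5 * (x + y) ^ 25 + 2 * a ^ 5 * (x + y) ^ 5 + c * (x + y)
        = (c ^ 5 * x ^ 25 + 2 * a ^ 5 * x ^ 5 + c * x) + (c ^ 5 * y ^ 25 + 2 * a ^ 5 * y ^ 5 + c * y)"
      by (simp only: frobenius_add) (simp add: algebra_simps)
    then show "x \<otimes>\<^bsub>M\<^esub> y \<in> radical c a"
      using x y by (simp add: M_def radical_def)
  qed (auto simp: M_def)
  have "card (radical c a) dvd 5 ^ r"
    using group.lagrange[OF M sub] by (simp add: order_def M_def card_field) (metis dvd_triv_right)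
  then obtain i where i: "card (radical c a) = 5 ^ i"
    by (auto simp: divides_primepow_nat)
  have "i \<le> 2"
  proof (rule ccontr)
    assume "\<not> i \<le> 2"
    then have "(5 :: nat) ^ 3 \<le> 5 ^ i" by (intro power_increasing) auto
    then show False using le i by simp
  qed
  then have "i = 0 \<or> i = 1 \<or> i = 2" by auto
  then show ?thesis using i by auto
qed

end

section \<open>Normalised values of the cubic sums\<close>

text \<open>Here \<open>X1\<close>, \<open>Y1\<close> are the cubic and twisted sums for \<open>(c, a)\<close> divided by the Gauss sum, and \<open>X2\<close>, \<open>Y2\<close> those for
  \<open>(2 * c, 2 * a)\<close>. The pairs of squares \<open>X1\<^sup>2, Y1\<^sup>2\<close> and \<open>X2\<^sup>2, Y2\<^sup>2\<close> have equal sums and equal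
  products, so they agree up to order. If they are swapped, then \<open>X1\<^sup>2\<close> is a root of \<open>X\<^sup>2 - 3 X + 1\<close>;
  otherwise the nine possible pairs \<open>(R, R')\<close> leave \<open>0\<close>, \<open>1\<close> and \<open>4\<close>.\<close>

lemma normalised_sum_values:
  fixes X1 X2 Y1 Y2 d d' :: complex and R R' :: nat
  assumes d: "d\<^sup>2 = 1" "d'\<^sup>2 = 1"
    and X: "X1\<^sup>2 = 1 + d * Y2" "X2\<^sup>2 = 1 + d' * Y1"
    and plus: "(X1 + Y1)\<^sup>2 = of_nat R" "(X2 + Y2)\<^sup>2 = of_nat R"
    and minus: "(X1 - Y1)\<^sup>2 = of_nat R'" "(X2 - Y2)\<^sup>2 = of_nat R'"
    and R: "R \<in> {1, 5, 25}" "R' \<in> {1, 5, 25}"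
  shows "X1\<^sup>2 \<in> {0, 1, 4} \<or> (X1\<^sup>2)\<^sup>2 - 3 * X1\<^sup>2 + 1 = 0"
proof -
  define a b where "a = X1\<^sup>2" and "b = Y1\<^sup>2"
  define s s' :: complex where "s = of_nat R" and "s' = of_nat R'"
  note plus = plus[folded s_def] and minus = minus[folded s'_def]
  have Y2: "Y2\<^sup>2 = (a - 1)\<^sup>2" using X(1) d(1) unfolding a_def by algebra
  have sum1: "2 * (a + b) = s + s'"
    unfolding a_def b_def plus(1)[symmetric] minus(1)[symmetric] by algebra
  have sum2: "X2\<^sup>2 + Y2\<^sup>2 = a + b"
  proof -
    have "2 * (X2\<^sup>2 + Y2\<^sup>2) = s + s'"
      unfolding plus(2)[symmetric] minus(2)[symmetric] by algebra
    then have "2 * (X2\<^sup>2 + Y2\<^sup>2) = 2 * (a + b)" using sum1 by (simp only:)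
    then show ?thesis by (simp only: mult_cancel_left) simp
  qed
  have prod1: "16 * (a * b) = (s - s')\<^sup>2"
    unfolding a_def b_def plus(1)[symmetric] minus(1)[symmetric] by algebra
  have prod2: "16 * (X2\<^sup>2 * Y2\<^sup>2) = (s - s')\<^sup>2"
    unfolding plus(2)[symmetric] minus(2)[symmetric] by algebra
  have "16 * (X2\<^sup>2 * Y2\<^sup>2) = 16 * (a * b)" using prod1 prod2 by (simp only:)
  then have "X2\<^sup>2 * Y2\<^sup>2 = a * b" by (simp only: mult_cancel_left) simp
  then have "(X2\<^sup>2 - a) * (X2\<^sup>2 - b) = 0" using sum2 by algebra
  then consider "X2\<^sup>2 = b" | "X2\<^sup>2 = a" by auto
  then show ?thesis
  proof cases
    case 1
    then have "a\<^sup>2 - 3 * a + 1 = 0" using sum2 Y2 by (simp add: power2_diff algebra_simps)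
    then show ?thesis by (simp add: a_def)
  next
    case 2
    then have b: "b = (a - 1)\<^sup>2" using sum2 Y2 by simp
    have "a = 0 \<or> a = 1 \<or> a = 4"
    proof -
      have quad: "2 * (a\<^sup>2 - a + 1) = s + s'" using sum1 b by algebra
      have cub: "16 * (a * (a - 1)\<^sup>2) = (s - s')\<^sup>2" using prod1 b by simp
      \<comment> \<open>Eliminating the higher powers of \<open>a\<close> leaves a linear relation.\<close>
      have lin: "8 * (s + s' - 2) * a = (s - s')\<^sup>2 + 8 * (s + s' - 2)"
        unfolding quad[symmetric] cub[symmetric] by algebra
      show ?thesis
      proof (cases "s + s' = 2")
        case True
        then have "a * (a - 1) = 0" using quad by (simp add: power2_eq_square algebra_simps)
        then show ?thesis by auto
      next
        case False
        define k where "k = s + s' - 2"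
        have "k \<noteq> 0" "8 * k * a = (s - s')\<^sup>2 + 8 * k"
          using False lin by (simp_all add: k_def)
        then have "a = 1 + (s - s')\<^sup>2 / (8 * k)" by (simp add: field_simps)
        note a = this[unfolded k_def]
        have "s \<in> {1, 5, 25}" "s' \<in> {1, 5, 25}" using R by (auto simp: s_def s'_def)
        then show ?thesis using quad False unfolding a by (auto simp: power2_eq_square)
      qed
    qed
    then show ?thesis by (auto simp: a_def)
  qed
qed

text \<open>The square \<open>w\<close> of \<open>z\<close> satisfies \<open>w + 1 / w = X\<^sup>2 - 2\<close>, which is the trace of a root of unity of order
  2, 3, 1 or 5, in the order of the listed values.\<close>

lemma root_of_unity_if_trace:
  fixes z X :: complex
  assumes z: "z\<^sup>2 + X * z + 1 = 0"
    and X: "X\<^sup>2 \<in> {0, 1, 4} \<or> (X\<^sup>2)\<^sup>2 - 3 * X\<^sup>2 + 1 = 0"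
  shows "z ^ 60 = 1"
proof -
  define w where "w = z\<^sup>2"
  have w: "w\<^sup>2 + 1 = (X\<^sup>2 - 2) * w" using z unfolding w_def by algebra
  have z60: "z ^ 60 = w ^ 30" by (simp add: w_def flip: power_mult)
  consider "X\<^sup>2 = 0" | "X\<^sup>2 = 1" | "X\<^sup>2 = 4" | "(X\<^sup>2)\<^sup>2 - 3 * X\<^sup>2 + 1 = 0" using X by auto
  then show ?thesis
  proof cases
    case 1
    then have "(w + 1)\<^sup>2 = 0" using w by (simp add: power2_sum)
    then have "w = - 1" by (simp add: eq_neg_iff_add_eq_0)
    then show ?thesis by (simp add: z60)
  next
    case 2
    then have "w ^ 3 = 1" using w by algebra
    then show ?thesis using power_mult[of w 3 10] by (simp add: z60)
  next
    case 3
    then have "(w - 1)\<^sup>2 = 0" using w by (simp add: power2_diff)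
    then show ?thesis by (simp add: z60)
  next
    case 4
    then have "w ^ 5 = 1" using w by algebra
    then show ?thesis using power_mult[of w 5 6] by (simp add: z60)
  qed
qed

context frobenius_invariant_character
begin

lemma cubic_sum_normalised:
  assumes "c \<noteq> 0"
  shows "(cubic_sum c a / gauss)\<^sup>2 \<in> {0, 1, 4} \<or>
    ((cubic_sum c a / gauss)\<^sup>2)\<^sup>2 - 3 * (cubic_sum c a / gauss)\<^sup>2 + 1 = 0"
proof -
  obtain g where g: "eta g = - 1" using ex_nonsquare by blast
  then have g0: "g \<noteq> 0" by (auto simp: eta_def)
  have rad: "radical (2 * c) (2 * a) = radical c a" for c a
  proof -
    have "(2 * c) ^ 5 * w ^ 25 + 2 * (2 * a) ^ 5 * w ^ 5 + 2 * c * w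
        = 2 * (c ^ 5 * w ^ 25 + 2 * a ^ 5 * w ^ 5 + c * w)" for w
      unfolding power_mult_distrib two_power_5 by (simp only: distrib_left mult_ac)
    then show ?thesis unfolding radical_def by (simp only: mult_eq_0_iff two_neq_0) simp
  qed
  have div: "(x / gauss)\<^sup>2 = of_nat n" if "x\<^sup>2 = q * of_nat n" for x n
    using that q_neq_0 by (simp add: power_divide gauss_squared)
  have plus: "((cubic_sum c a + twisted_sum c a) / gauss)\<^sup>2 = of_nat (card (radical c a))" for c a
    by (rule div) (simp add: sextic_sum_squared flip: sextic_sum_eq)
  have minus: "((cubic_sum c a - twisted_sum c a) / gauss)\<^sup>2 = of_nat (card (radical (c * g ^ 3) (a * g)))" for c a
    by (rule div) (simp add: sextic_sum_squared flip: sextic_sum_twist[OF g])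
  have sq: "(cubic_sum c a / gauss)\<^sup>2 = 1 + eta c * (twisted_sum (2 * c) (2 * a) / gauss)" if "c \<noteq> 0" for c a
    using cubic_sum_squared[OF that, of a] gauss_neq_0
    by (simp add: power_divide add_divide_distrib gauss_squared[symmetric] power2_eq_square)
  have "twisted_sum (2 * (2 * c)) (2 * (2 * a)) = twisted_sum (- c) (- a)"
    by (simp add: four_eq)
  then have sq2: "(cubic_sum (2 * c) (2 * a) / gauss)\<^sup>2 = 1 + eta (2 * c) * (twisted_sum c a / gauss)"
    using sq[of "2 * c" "2 * a"] assms by (simp add: twisted_sum_uminus)
  show ?thesis
  proof (rule normalised_sum_values[OF _ _ sq[OF assms] sq2])
    show "(eta c)\<^sup>2 = 1" "(eta (2 * c))\<^sup>2 = 1"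
      using assms by (simp_all add: power2_eq_square eta_sq)
    show "(cubic_sum c a / gauss + twisted_sum c a / gauss)\<^sup>2 = of_nat (card (radical c a))"
      using plus[of c a] by (simp add: add_divide_distrib)
    show "(cubic_sum (2 * c) (2 * a) / gauss + twisted_sum (2 * c) (2 * a) / gauss)\<^sup>2 = of_nat (card (radical c a))"
      using plus[of "2 * c" "2 * a"] by (simp add: add_divide_distrib rad)
    show "(cubic_sum c a / gauss - twisted_sum c a / gauss)\<^sup>2 = of_nat (card (radical (c * g ^ 3) (a * g)))"
      using minus[of c a] by (simp add: diff_divide_distrib)
    show "(cubic_sum (2 * c) (2 * a) / gauss - twisted_sum (2 * c) (2 * a) / gauss)\<^sup>2
        = of_nat (card (radical (c * g ^ 3) (a * g)))"
      using minus[of "2 * c" "2 * a"] rad[of "c * g ^ 3" "a * g"]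
      by (simp add: diff_divide_distrib mult.assoc)
    show "card (radical c a) \<in> {1, 5, 25}" using assms by (rule card_radical)
    show "card (radical (c * g ^ 3) (a * g)) \<in> {1, 5, 25}"
      using assms g0 by (intro card_radical) simp
  qed
qed

end

section \<open>The von Mangoldt function on polynomials\<close>

lemma mangoldt_poly_eq_degree:
  assumes "is_power_of_monic_irreducible f P"
  shows "mangoldt_poly f = degree P"
proof -
  have "(THE P. is_power_of_monic_irreducible f P) = P"
    using assms is_power_of_monic_irreducible_unique by (intro the_equality)
  then show ?thesis using assms by (auto simp: mangoldt_poly_def)
qed

lemma lead_coeff_if_is_power:
  "is_power_of_monic_irreducible f P \<Longrightarrow> lead_coeff f = 1"
  by (auto simp: is_power_of_monic_irreducible_def lead_coeff_power)

lemma monic_dvd_1: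
  assumes "lead_coeff d = 1" "d dvd (1 :: 'a::field poly)"
  shows "d = 1"
proof -
  obtain c where "d = [:c:]" using assms(2) by (auto simp: is_unit_poly_iff)
  then show ?thesis using assms(1) by (simp add: one_pCons split: if_splits)
qed

lemma mangoldt_poly_1: "mangoldt_poly (1 :: 'a::finite_field poly) = 0"
proof -
  have False if "is_power_of_monic_irreducible (1 :: 'a poly) P" for P
  proof -
    obtain k where "k \<ge> 1" "1 = P ^ k" "irreducible P"
      using \<open>is_power_of_monic_irreducible 1 P\<close> by (auto simp: is_power_of_monic_irreducible_def)
    then show False by (metis dvd_power irreducible_not_unit less_le_trans zero_less_one)
  qed
  then show ?thesis by (auto simp: mangoldt_poly_def)
qed

lemma exists_monic_irreducible_factor:
  fixes f :: "'a::field poly"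
  assumes "degree f > 0"
  shows "\<exists>P. lead_coeff P = 1 \<and> irreducible P \<and> P dvd f"
  using assms
proof (induction "degree f" arbitrary: f rule: less_induct)
  case less
  have f0: "f \<noteq> 0" using less.prems by auto
  show ?case
  proof (cases "irreducible f")
    case True
    define P where "P = smult (inverse (lead_coeff f)) f"
    have "irreducible ([:inverse (lead_coeff f):] * f)"
      using f0 True by (subst irreducible_mult_unit_left) (auto simp: is_unit_poly_iff dvd_field_iff)
    then have "irreducible P" by (simp add: P_def)
    moreover have "lead_coeff P = 1" "P dvd f" using f0 by (simp_all add: P_def smult_dvd_iff)
    ultimately show ?thesis by blast
  next
    case False
    then obtain g h where gh: "f = g * h" "\<not> is_unit g" "\<not> is_unit h"
      using f0 less.prems unfolding irreducible_def by (auto simp: is_unit_iff_degree)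
    have "degree g > 0" "degree h > 0"
      using gh f0 by (auto simp: is_unit_iff_degree)
    then have "degree g < degree f" using gh f0 by (simp add: degree_mult_eq)
    then show ?thesis using less.hyps[of g] \<open>degree g > 0\<close> gh(1) by (meson dvd_mult2)
  qed
qed

text \<open>The factor \<open>P ^ m\<close> takes out every occurrence of \<open>P\<close> in \<open>f\<close>.\<close>

lemma split_off_power:
  fixes f P :: "'a::field poly"
  assumes "f \<noteq> 0" "degree P > 0"
  shows "\<exists>m g. f = P ^ m * g \<and> \<not> P dvd g"
  using assms(1)
proof (induction "degree f" arbitrary: f rule: less_induct)
  case less
  show ?case
  proof (cases "P dvd f")
    case True
    then obtain h where h: "f = P * h" by blast
    then have "h \<noteq> 0" "degree h < degree f" using less.prems assms(2) by (auto simp: degree_mult_eq)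
    then obtain m g where "h = P ^ m * g" "\<not> P dvd g" using less.hyps by blast
    then have "f = P ^ Suc m * g" "\<not> P dvd g" by (simp_all add: h mult.assoc)
    then show ?thesis by blast
  qed (intro exI[of _ 0] exI[of _ f], simp)
qed

lemma finite_monic_divisors:
  fixes f :: "'a::finite_field poly"
  assumes "f \<noteq> 0"
  shows "finite {d. lead_coeff d = 1 \<and> d dvd f}"
proof (rule finite_subset)
  show "{d. lead_coeff d = 1 \<and> d dvd f} \<subseteq> (\<Union>n\<le>degree f. monic_polys n)"
    using assms by (auto simp: monic_polys_def dvd_imp_degree_le)
qed (auto simp: finite_monic_polys)

text \<open>The prime-power divisors of \<open>P ^ m * g\<close>, where \<open>P\<close> does not divide \<open>g\<close>, are the powers of \<open>P\<close>
  up to \<open>P ^ m\<close> and the prime-power divisors of \<open>g\<close>.\<close>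

theorem sum_mangoldt_poly_divisors:
  fixes f :: "'a::finite_field poly"
  assumes "lead_coeff f = 1"
  shows "(\<Sum>d | lead_coeff d = 1 \<and> d dvd f. mangoldt_poly d) = degree f"
  using assms
proof (induction "degree f" arbitrary: f rule: less_induct)
  case less
  define PP where "PP f = {d. d dvd f \<and> (\<exists>Q. is_power_of_monic_irreducible d Q)}" for f :: "'a poly"
  have PP_finite: "finite (PP f)" if "lead_coeff f = 1" for f
    by (rule finite_subset[OF _ finite_monic_divisors[of f]])
      (use that in \<open>auto simp: PP_def lead_coeff_if_is_power\<close>)
  have sum_PP: "(\<Sum>d | lead_coeff d = 1 \<and> d dvd f. mangoldt_poly d) = (\<Sum>d\<in>PP f. mangoldt_poly d)"
    if "lead_coeff f = 1" for f
    by (rule sum.mono_neutral_right)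
      (use that in \<open>auto simp: PP_def lead_coeff_if_is_power mangoldt_poly_def intro!: finite_monic_divisors\<close>)
  show ?case
  proof (cases "degree f = 0")
    case True
    then have "f = 1" using less.prems by (auto elim!: degree_eq_zeroE simp: one_pCons)
    moreover have "{d :: 'a poly. lead_coeff d = 1 \<and> d dvd 1} = {1}" using monic_dvd_1 by auto
    ultimately show ?thesis by (simp add: mangoldt_poly_1)
  next
    case False
    then obtain P where P: "lead_coeff P = 1" "irreducible P" "P dvd f"
      using exists_monic_irreducible_factor[of f] by auto
    have degP: "degree P > 0" using P(2) by (auto simp: irreducible_def is_unit_iff_degree)
    have f0: "f \<noteq> 0" using less.prems by auto
    obtain m g where f: "f = P ^ m * g" "\<not> P dvd g" using split_off_power[OF f0 degP] by blast
    have m: "m > 0" using f P(3) by (cases m) auto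
    have g: "lead_coeff g = 1"
      using less.prems P(1) by (simp add: f(1) lead_coeff_mult lead_coeff_power)
    have deg: "degree f = m * degree P + degree g"
      using f0 unfolding f(1) by (subst degree_mult_eq) (auto simp: degree_power_eq)
    have inj: "inj_on ((^) P) {1..m}"
    proof (rule inj_onI)
      fix i j assume "P ^ i = P ^ j"
      then have "degree (P ^ i) = degree (P ^ j)" by simp
      moreover have "P \<noteq> 0" using degP by auto
      ultimately show "i = j" using degP by (simp add: degree_power_eq)
    qed
    have "PP f = (^) P ` {1..m} \<union> PP g"
    proof (intro equalityI subsetI)
      fix d assume "d \<in> PP f"
      then obtain Q k where d: "d dvd f" "lead_coeff Q = 1" "irreducible Q" "k \<ge> 1" "d = Q ^ k"
        by (auto simp: PP_def is_power_of_monic_irreducible_def)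
      have primeQ: "prime_elem Q" using d(3) by (rule field_poly_irreducible_imp_prime)
      show "d \<in> (^) P ` {1..m} \<union> PP g"
      proof (cases "Q = P")
        case True
        have "k \<le> m"
        proof (rule ccontr)
          assume "\<not> k \<le> m"
          then have "P ^ Suc m dvd P ^ m * g"
            using d True f(1) by (metis le_imp_power_dvd dvd_trans not_less_eq_eq)
          then show False using f(2) P(2) by (auto simp: mult.commute)
        qed
        then show ?thesis using d True by auto
      next
        case False
        have "\<not> Q dvd P ^ m"
        proof
          assume "Q dvd P ^ m"
          then have "Q dvd P" using primeQ prime_elem_dvd_power by blast
          then obtain c where c: "P = Q * c" by blast
          then have "is_unit c" using P(2) d(3) unfolding irreducible_def by blast
          have "lead_coeff c = 1" using c P(1) d(2) by (simp add: lead_coeff_mult)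
          then have "c = 1" using \<open>is_unit c\<close> monic_dvd_1 by blast
          then show False using c False by simp
        qed
        then have "Q ^ k dvd g"
          using prime_power_dvd_multD[OF primeQ, of k "P ^ m" g] d f(1) by auto
        then show ?thesis using d by (auto simp: PP_def is_power_of_monic_irreducible_def)
      qed
    next
      fix d assume "d \<in> (^) P ` {1..m} \<union> PP g"
      then show "d \<in> PP f"
      proof
        assume "d \<in> (^) P ` {1..m}"
        then obtain j where j: "j \<ge> 1" "j \<le> m" "d = P ^ j" by auto
        then have "d dvd f" by (simp add: f(1) le_imp_power_dvd)
        moreover have "is_power_of_monic_irreducible d P"
          using P j by (auto simp: is_power_of_monic_irreducible_def)
        ultimately show ?thesis by (auto simp: PP_def)
      next
        assume "d \<in> PP g"
        then show ?thesis by (auto simp: PP_def f(1))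
      qed
    qed
    moreover have "(^) P ` {1..m} \<inter> PP g = {}"
    proof -
      have "\<not> P ^ j dvd g" if "j \<in> {1..m}" for j
      proof -
        have "P dvd P ^ j" using that by (intro dvd_power) auto
        then show ?thesis using f(2) dvd_trans by blast
      qed
      then show ?thesis by (auto simp: PP_def)
    qed
    ultimately have "(\<Sum>d\<in>PP f. mangoldt_poly d)
        = (\<Sum>d\<in>(^) P ` {1..m}. mangoldt_poly d) + (\<Sum>d\<in>PP g. mangoldt_poly d)"
      using PP_finite[OF g] by (simp add: sum.union_disjoint)
    also have "(\<Sum>d\<in>(^) P ` {1..m}. mangoldt_poly d) = (\<Sum>j\<in>{1..m}. degree P)"
      unfolding sum.reindex[OF inj] comp_def
      by (intro sum.cong refl mangoldt_poly_eq_degree)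
        (use P in \<open>auto simp: is_power_of_monic_irreducible_def\<close>)
    also have "(\<Sum>d\<in>PP g. mangoldt_poly d) = degree g"
      using less.hyps[of g] deg degP m g by (simp add: sum_PP)
    finally show ?thesis using less.prems deg by (simp add: sum_PP)
  qed
qed

text \<open>Summing \<open>deg f * h f\<close> over the monic \<open>f = d * e\<close> of degree \<open>n\<close>, with the degree written as the sum
  of the von Mangoldt function over the divisors \<open>d\<close>.\<close>

theorem mangoldt_poly_convolution:
  fixes h :: "'a::finite_field poly \<Rightarrow> complex"
  assumes "\<And>f g. lead_coeff f = 1 \<Longrightarrow> lead_coeff g = 1 \<Longrightarrow> h (f * g) = h f * h g"
  shows "of_nat n * (\<Sum>f\<in>monic_polys n. h f) =
    (\<Sum>k\<le>n. (\<Sum>d\<in>monic_polys k. of_nat (mangoldt_poly d) * h d) * (\<Sum>e\<in>monic_polys (n - k). h e))"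
proof -
  let ?D = "\<lambda>f :: 'a poly. {d. lead_coeff d = 1 \<and> d dvd f}"
  have "of_nat n * (\<Sum>f\<in>monic_polys n. h f)
      = (\<Sum>f\<in>monic_polys n. \<Sum>d\<in>?D f. of_nat (mangoldt_poly d) * h f)"
    unfolding sum_distrib_left
  proof (intro sum.cong refl)
    fix f :: "'a poly" assume "f \<in> monic_polys n"
    then have "of_nat n = (of_nat (\<Sum>d\<in>?D f. mangoldt_poly d) :: complex)"
      by (subst sum_mangoldt_poly_divisors) (auto simp: monic_polys_def)
    then show "of_nat n * h f = (\<Sum>d\<in>?D f. of_nat (mangoldt_poly d) * h f)"
      by (simp add: sum_distrib_right)
  qed
  also have "\<dots> = (\<Sum>(f, d)\<in>Sigma (monic_polys n) ?D. of_nat (mangoldt_poly d) * h f)"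
    by (rule sum.Sigma) (auto intro!: finite_monic_divisors simp: finite_monic_polys, auto simp: monic_polys_def)
  also have "\<dots> = (\<Sum>(k, d, e)\<in>Sigma {..n} (\<lambda>k. monic_polys k \<times> monic_polys (n - k)).
      (of_nat (mangoldt_poly d) * h d) * h e)"
  proof (rule sum.reindex_bij_witness[of _ "\<lambda>(k, d, e). (d * e, d)" "\<lambda>(f, d). (degree d, d, f div d)"], safe)
    fix f d :: "'a poly"
    assume f: "f \<in> monic_polys n" and d: "lead_coeff d = 1" "d dvd f"
    then obtain e where e: "f = d * e" by blast
    have f0: "f \<noteq> 0" using f by (auto simp: monic_polys_def)
    then have nz: "d \<noteq> 0" "e \<noteq> 0" using e by auto
    then have fde: "f div d = e" by (simp add: e)
    have le: "lead_coeff e = 1" using f d e by (simp add: monic_polys_def lead_coeff_mult)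
    have deg: "degree f = degree d + degree e" using nz by (simp add: e degree_mult_eq)
    show "degree d \<le> n" using deg f by (simp add: monic_polys_def)
    show "d \<in> monic_polys (degree d)" using d by (simp add: monic_polys_def)
    show "f div d \<in> monic_polys (n - degree d)" using f deg le by (auto simp: monic_polys_def fde)
    show "d * (f div d) = f" using e fde by simp
    have "h f = h d * h e" unfolding e using d(1) le by (rule assms)
    then show "(of_nat (mangoldt_poly d) * h d) * h (f div d) = of_nat (mangoldt_poly d) * h f"
      by (simp add: fde)
  next
    fix k and d e :: "'a poly"
    assume k: "k \<le> n" and d: "d \<in> monic_polys k" and e: "e \<in> monic_polys (n - k)"
    have nz: "d \<noteq> 0" "e \<noteq> 0" using d e by (auto simp: monic_polys_def)
    show "degree d = k" "lead_coeff d = 1" using d by (auto simp: monic_polys_def)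
    show "d * e div d = e" using nz by simp
    have "lead_coeff (d * e) = 1"
      using d e unfolding lead_coeff_mult by (auto simp: monic_polys_def)
    moreover have "degree (d * e) = n"
      using d e nz k by (simp add: monic_polys_def degree_mult_eq)
    ultimately show "d * e \<in> monic_polys n" by (auto simp: monic_polys_def)
  qed auto
  also have "\<dots> = (\<Sum>k\<le>n. \<Sum>(d, e)\<in>monic_polys k \<times> monic_polys (n - k).
      (of_nat (mangoldt_poly d) * h d) * h e)"
    by (rule sum.Sigma[symmetric]) (auto simp: finite_monic_polys)
  also have "\<dots> = (\<Sum>k\<le>n. (\<Sum>d\<in>monic_polys k. of_nat (mangoldt_poly d) * h d)
      * (\<Sum>e\<in>monic_polys (n - k). h e))"
    by (simp add: sum_product sum.cartesian_product)
  finally show ?thesis .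
qed

section \<open>Next-to-leading coefficients\<close>

lemma next_to_leading_eq_reflect: "next_to_leading j f = coeff (reflect_poly f) j"
  by (simp add: next_to_leading_def coeff_reflect_poly)

text \<open>The reversal of polynomials is multiplicative and turns the next-to-leading coefficients into
  the lowest ones.\<close>

lemma next_to_leading_mult:
  fixes f g :: "'a::finite_field poly"
  assumes "lead_coeff f = 1" "lead_coeff g = 1"
  shows "next_to_leading 1 (f * g) = next_to_leading 1 f + next_to_leading 1 g"
    and "next_to_leading 2 (f * g) = next_to_leading 2 f
      + next_to_leading 1 f * next_to_leading 1 g + next_to_leading 2 g"
    and "next_to_leading 3 (f * g) = next_to_leading 3 f + next_to_leading 2 f * next_to_leading 1 g
      + next_to_leading 1 f * next_to_leading 2 g + next_to_leading 3 g"
proof -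
  have "coeff (reflect_poly f) 0 = 1" "coeff (reflect_poly g) 0 = 1"
    using assms by (simp_all add: coeff_reflect_poly)
  then show "next_to_leading 1 (f * g) = next_to_leading 1 f + next_to_leading 1 g"
    and "next_to_leading 2 (f * g) = next_to_leading 2 f
      + next_to_leading 1 f * next_to_leading 1 g + next_to_leading 2 g"
    and "next_to_leading 3 (f * g) = next_to_leading 3 f + next_to_leading 2 f * next_to_leading 1 g
      + next_to_leading 1 f * next_to_leading 2 g + next_to_leading 3 g"
    by (simp_all add: next_to_leading_eq_reflect reflect_poly_mult coeff_mult
        atMost_Suc numeral_2_eq_2 numeral_3_eq_3 algebra_simps del: reflect_poly_at_0_eq_0_iff coeff_0_reflect_poly)
qed

lemma monic_polys_0: "monic_polys 0 = {1 :: 'a::finite_field poly}"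
  by (auto simp: monic_polys_def one_pCons elim!: degree_eq_zeroE)

lemma sum_monic_polys_Suc:
  fixes F :: "'a::finite_field poly \<Rightarrow> complex"
  shows "(\<Sum>f\<in>monic_polys (Suc n). F f) = (\<Sum>g\<in>monic_polys n. \<Sum>a\<in>UNIV. F (pCons a g))"
  unfolding sum.cartesian_product
proof (rule sum.reindex_bij_witness[of _ "\<lambda>(g, a). pCons a g" "\<lambda>f. (THE g. \<exists>a. f = pCons a g, coeff f 0)"])
  fix f :: "'a poly" assume f: "f \<in> monic_polys (Suc n)"
  obtain a g where fg: "f = pCons a g" by (cases f) auto
  have the: "(THE g. \<exists>a. f = pCons a g) = g" by (auto simp: fg)
  have "g \<noteq> 0" using f by (auto simp: fg monic_polys_def)
  then have "g \<in> monic_polys n" using f by (auto simp: fg monic_polys_def)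
  then show "(THE g. \<exists>a. f = pCons a g, coeff f 0) \<in> monic_polys n \<times> UNIV" by (simp add: the)
  show "(case (THE g. \<exists>a. f = pCons a g, coeff f 0) of (g, a) \<Rightarrow> pCons a g) = f"
    unfolding the by (simp add: fg)
  show "(case (THE g. \<exists>a. f = pCons a g, coeff f 0) of (g, a) \<Rightarrow> F (pCons a g)) = F f"
    unfolding the by (simp add: fg)
next
  fix b :: "'a poly \<times> 'a" assume b: "b \<in> monic_polys n \<times> UNIV"
  obtain g a where ga: "b = (g, a)" by force
  show "(case b of (g, a) \<Rightarrow> pCons a g) \<in> monic_polys (Suc n)"
    using b by (auto simp: ga monic_polys_def)
  show "(THE g. \<exists>a. (case b of (g, a) \<Rightarrow> pCons a g) = pCons a g, coeff (case b of (g, a) \<Rightarrow> pCons a g) 0) = b"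
    by (simp add: ga)
qed

lemma next_to_leading_pCons:
  assumes "g \<noteq> 0" "j \<le> degree g"
  shows "next_to_leading j (pCons a g) = next_to_leading j g"
  using assms by (simp add: next_to_leading_def Suc_diff_le)

text \<open>In degree at least 3, the first three next-to-leading coefficients are equidistributed.\<close>

lemma sum_next_to_leading:
  fixes F :: "'a::finite_field \<Rightarrow> 'a \<Rightarrow> 'a \<Rightarrow> complex"
  shows "(\<Sum>f\<in>monic_polys (n + 3). F (next_to_leading 1 f) (next_to_leading 2 f) (next_to_leading 3 f))
    = of_nat CARD('a) ^ n * (\<Sum>t1\<in>UNIV. \<Sum>t2\<in>UNIV. \<Sum>t3\<in>UNIV. F t1 t2 t3)"
proof (induction n)
  case 0
  have "monic_polys (0 + 3) = (monic_polys (Suc (Suc (Suc 0))) :: 'a poly set)"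
    by (simp add: numeral_3_eq_3)
  then show ?case
    by (simp add: sum_monic_polys_Suc monic_polys_0 next_to_leading_def one_pCons numeral_2_eq_2 numeral_3_eq_3)
next
  case (Suc n)
  have "next_to_leading j (pCons a g) = next_to_leading j g"
    if "g \<in> monic_polys (n + 3)" "j \<le> 3" for a j and g :: "'a poly"
    using that by (intro next_to_leading_pCons) (auto simp: monic_polys_def)
  then have "(\<Sum>f\<in>monic_polys (Suc n + 3). F (next_to_leading 1 f) (next_to_leading 2 f) (next_to_leading 3 f))
    = (\<Sum>g\<in>monic_polys (n + 3). of_nat CARD('a) * F (next_to_leading 1 g) (next_to_leading 2 g) (next_to_leading 3 g))"
    unfolding add_Suc sum_monic_polys_Suc by (intro sum.cong refl) simp
  then show ?case by (simp only: Suc.IH power_Suc mult.assoc flip: sum_distrib_left)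
qed

section \<open>Character sums over monic polynomials\<close>

lemma newton_recurrence_unique:
  fixes a P P' :: "nat \<Rightarrow> complex"
  assumes "a 0 = 1"
    and "\<And>n. of_nat n * a n = (\<Sum>k\<le>n. P k * a (n - k))"
    and "\<And>n. of_nat n * a n = (\<Sum>k\<le>n. P' k * a (n - k))"
  shows "P n = P' n"
proof (induction n rule: less_induct)
  case (less n)
  have "(\<Sum>k<n. P k * a (n - k)) + P n = (\<Sum>k<n. P' k * a (n - k)) + P' n"
    using assms(2)[of n] assms(3)[of n] by (simp add: assms(1) flip: lessThan_Suc_atMost)
  moreover have "(\<Sum>k<n. P k * a (n - k)) = (\<Sum>k<n. P' k * a (n - k))"
    using less by (intro sum.cong) auto
  ultimately show ?case by simp
qed

text \<open>The solution of Newton's recurrence for the series \<open>1 + a1 u + a2 u\<^sup>2 = (1 - \<alpha> u) (1 - \<beta> u)\<close>.\<close>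

lemma newton_recurrence_quadratic:
  fixes a :: "nat \<Rightarrow> complex"
  assumes "a 0 = 1" "a 1 = - (\<alpha> + \<beta>)" "a 2 = \<alpha> * \<beta>" "\<And>n. n \<ge> 3 \<Longrightarrow> a n = 0"
  shows "of_nat n * a n = (\<Sum>k\<le>n. (if k = 0 then 0 else - (\<alpha> ^ k + \<beta> ^ k)) * a (n - k))"
proof -
  consider "n = 0" | "n = 1" | "n = 2" | "n \<ge> 3" by linarith
  then show ?thesis
  proof cases
    case 3
    then show ?thesis using assms
      by (simp add: numeral_2_eq_2 atMost_Suc) (simp (no_asm) add: algebra_simps)
  next
    case ge3: 4
    define m where "m = n - 3"
    have 4: "n = m + 3" using ge3 by (simp add: m_def)
    have "(\<Sum>k\<le>n. (if k = 0 then 0 else - (\<alpha> ^ k + \<beta> ^ k)) * a (n - k))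
      = (\<Sum>k\<in>{m + 1, m + 2, m + 3}. (if k = 0 then 0 else - (\<alpha> ^ k + \<beta> ^ k)) * a (n - k))"
      by (rule sum.mono_neutral_right) (use assms(4) 4 in auto)
    also have "\<dots> = 0" using assms 4 
      by (simp add: numeral_2_eq_2 numeral_3_eq_3) (simp (no_asm) add: algebra_simps)
    finally show ?thesis using assms(4) 4 by simp
  qed (use assms in auto)
qed

context frobenius_invariant_character
begin

text \<open>A linear combination of the first three power sums of the roots, in terms of the first three
  next-to-leading coefficients (Newton's identities).\<close>

definition phase :: "'a \<Rightarrow> 'a \<Rightarrow> 'a \<Rightarrow> 'a \<Rightarrow> 'a \<Rightarrow> 'a \<Rightarrow> 'a" where
  "phase c1 c2 c3 t1 t2 t3 = c1 * (- t1) + c2 * (t1\<^sup>2 - 2 * t2) + c3 * (- (t1 ^ 3) + 3 * t1 * t2 - 3 * t3)"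

text \<open>The characters on monic polynomials that depend only on the first three next-to-leading
  coefficients, their sums over one degree, and the sums weighted by the von Mangoldt function.\<close>

definition chi :: "'a \<Rightarrow> 'a \<Rightarrow> 'a \<Rightarrow> 'a poly \<Rightarrow> complex" where
  "chi c1 c2 c3 f = \<psi> (phase c1 c2 c3 (next_to_leading 1 f) (next_to_leading 2 f) (next_to_leading 3 f))"

definition chi_sum :: "'a \<Rightarrow> 'a \<Rightarrow> 'a \<Rightarrow> nat \<Rightarrow> complex" where
  "chi_sum c1 c2 c3 n = (\<Sum>f\<in>monic_polys n. chi c1 c2 c3 f)"

definition chi_psi :: "'a \<Rightarrow> 'a \<Rightarrow> 'a \<Rightarrow> nat \<Rightarrow> complex" where
  "chi_psi c1 c2 c3 n = (\<Sum>f\<in>monic_polys n. of_nat (mangoldt_poly f) * chi c1 c2 c3 f)"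

lemma chi_mult:
  assumes "lead_coeff f = 1" "lead_coeff g = 1"
  shows "chi c1 c2 c3 (f * g) = chi c1 c2 c3 f * chi c1 c2 c3 g"
  unfolding chi_def \<psi>_add[symmetric] next_to_leading_mult[OF assms] phase_def
  by (rule arg_cong[of _ _ \<psi>]) (simp add: power2_eq_square power3_eq_cube algebra_simps)

lemma chi_psi_recurrence:
  "of_nat n * chi_sum c1 c2 c3 n = (\<Sum>k\<le>n. chi_psi c1 c2 c3 k * chi_sum c1 c2 c3 (n - k))"
  unfolding chi_sum_def chi_psi_def by (rule mangoldt_poly_convolution) (rule chi_mult)

lemma chi_sum_0: "chi_sum c1 c2 c3 0 = 1"
  by (simp add: chi_sum_def monic_polys_0 chi_def next_to_leading_def phase_def \<psi>_0)

text \<open>The value of the exponent at \<open>T - x\<close>.\<close>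

definition cubic :: "'a \<Rightarrow> 'a \<Rightarrow> 'a \<Rightarrow> 'a \<Rightarrow> 'a" where
  "cubic c1 c2 c3 x = c1 * x + c2 * x\<^sup>2 + c3 * x ^ 3"

lemma chi_sum_1: "chi_sum c1 c2 c3 1 = (\<Sum>x\<in>UNIV. \<psi> (cubic c1 c2 c3 x))"
proof -
  have "chi_sum c1 c2 c3 1 = (\<Sum>x\<in>UNIV. \<psi> (phase c1 c2 c3 x 0 0))"
    unfolding chi_sum_def chi_def One_nat_def sum_monic_polys_Suc
    by (simp add: monic_polys_0 next_to_leading_def one_pCons)
  also have "\<dots> = (\<Sum>x\<in>UNIV. \<psi> (cubic c1 c2 c3 x))"
    by (rule sum.reindex_bij_witness[of _ uminus uminus]) (auto simp: phase_def cubic_def)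
  finally show ?thesis .
qed

lemma chi_sum_2:
  "chi_sum c1 c2 c3 2 = (\<Sum>x\<in>UNIV. \<psi> (cubic c1 c2 c3 x) * (q * of_bool (2 * c2 + 3 * c3 * x = 0)))"
proof -
  have "chi_sum c1 c2 c3 2 = (\<Sum>x\<in>UNIV. \<Sum>y\<in>UNIV. \<psi> (phase c1 c2 c3 x y 0))"
    unfolding chi_sum_def chi_def numeral_2_eq_2 One_nat_def sum_monic_polys_Suc
    by (simp add: monic_polys_0 next_to_leading_def one_pCons numeral_2_eq_2)
  also have "\<dots> = (\<Sum>x\<in>UNIV. \<Sum>y\<in>UNIV. \<psi> (phase c1 c2 c3 (- x) y 0))"
    by (rule sum.reindex_bij_witness[of _ uminus uminus]) auto
  also have "\<dots> = (\<Sum>x\<in>UNIV. \<Sum>y\<in>UNIV. \<psi> (cubic c1 c2 c3 x) * \<psi> (- (2 * c2 + 3 * c3 * x) * y))"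
    unfolding \<psi>_add[symmetric]
    by (intro sum.cong refl arg_cong[of _ _ \<psi>]) (simp add: phase_def cubic_def algebra_simps)
  also have "\<dots> = (\<Sum>x\<in>UNIV. \<psi> (cubic c1 c2 c3 x) * (q * of_bool (2 * c2 + 3 * c3 * x = 0)))"
    unfolding sum_distrib_left[symmetric] sum_\<psi>_mult neg_equal_0_iff_equal by simp
  finally show ?thesis .
qed

lemma chi_sum_ge_3:
  assumes "n \<ge> 3"
  shows "chi_sum c1 c2 c3 n = q ^ n * of_bool (c1 = 0 \<and> c2 = 0 \<and> c3 = 0)"
proof -
  obtain m where n: "n = m + 3" using assms by (metis le_add_diff_inverse2)
  have "(\<Sum>t3\<in>UNIV. \<psi> (phase c1 c2 c3 t1 t2 t3))
      = \<psi> (phase c1 c2 c3 t1 t2 0) * (q * of_bool (c3 = 0))" for t1 t2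
  proof -
    have "(\<Sum>t3\<in>UNIV. \<psi> (phase c1 c2 c3 t1 t2 t3))
        = (\<Sum>t3\<in>UNIV. \<psi> (phase c1 c2 c3 t1 t2 0) * \<psi> ((- 3 * c3) * t3))"
      unfolding \<psi>_add[symmetric] by (simp add: phase_def algebra_simps)
    then show ?thesis by (simp only: sum_\<psi>_mult flip: sum_distrib_left) simp
  qed
  moreover have "(\<Sum>t2\<in>UNIV. \<psi> (phase c1 c2 c3 t1 t2 0) * (q * of_bool (c3 = 0)))
      = \<psi> (phase c1 c2 c3 t1 0 0) * (q\<^sup>2 * of_bool (c2 = 0 \<and> c3 = 0))" for t1
  proof (cases "c3 = 0")
    case True
    have "(\<Sum>t2\<in>UNIV. \<psi> (phase c1 c2 0 t1 t2 0))
        = (\<Sum>t2\<in>UNIV. \<psi> (phase c1 c2 0 t1 0 0) * \<psi> ((- 2 * c2) * t2))"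
      unfolding \<psi>_add[symmetric] by (simp add: phase_def algebra_simps)
    also have "\<dots> = \<psi> (phase c1 c2 0 t1 0 0) * (q * of_bool (c2 = 0))"
      by (simp only: sum_\<psi>_mult flip: sum_distrib_left) simp
    finally show ?thesis using True by (simp add: power2_eq_square flip: sum_distrib_right)
  qed simp
  moreover have "(\<Sum>t1\<in>UNIV. \<psi> (phase c1 c2 c3 t1 0 0) * (q\<^sup>2 * of_bool (c2 = 0 \<and> c3 = 0)))
      = q ^ 3 * of_bool (c1 = 0 \<and> c2 = 0 \<and> c3 = 0)"
  proof (cases "c2 = 0 \<and> c3 = 0")
    case True
    have "(\<Sum>t1\<in>UNIV. \<psi> (phase c1 0 0 t1 0 0)) = (\<Sum>t1\<in>UNIV. \<psi> ((- c1) * t1))"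
      by (simp add: phase_def)
    also have "\<dots> = q * of_bool (c1 = 0)" by (simp only: sum_\<psi>_mult) simp
    finally show ?thesis using True
      by (simp add: power2_eq_square power3_eq_cube flip: sum_distrib_right)
  qed auto
  ultimately have "(\<Sum>t1\<in>UNIV. \<Sum>t2\<in>UNIV. \<Sum>t3\<in>UNIV. \<psi> (phase c1 c2 c3 t1 t2 t3))
      = q ^ 3 * of_bool (c1 = 0 \<and> c2 = 0 \<and> c3 = 0)"
    by (simp only:)
  then show ?thesis
    unfolding chi_sum_def chi_def n sum_next_to_leading[of "\<lambda>x y z. \<psi> (phase c1 c2 c3 x y z)"]
    by (simp add: card_field power_add)
qed

lemma chi_psi_quadratic:
  assumes "chi_sum c1 c2 c3 1 = - (\<alpha> + \<beta>)" "chi_sum c1 c2 c3 2 = \<alpha> * \<beta>"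
    and "\<not> (c1 = 0 \<and> c2 = 0 \<and> c3 = 0)" "n > 0"
  shows "chi_psi c1 c2 c3 n = - (\<alpha> ^ n + \<beta> ^ n)"
proof -
  have "chi_psi c1 c2 c3 n = (if n = 0 then 0 else - (\<alpha> ^ n + \<beta> ^ n))"
    by (rule newton_recurrence_unique[OF chi_sum_0 chi_psi_recurrence newton_recurrence_quadratic])
      (use assms in \<open>auto simp: chi_sum_0 chi_sum_ge_3\<close>)
  then show ?thesis using assms by simp
qed

lemma chi_sum_trivial: "chi_sum 0 0 0 n = q ^ n"
proof -
  consider "n = 0" | "n = 1" | "n = 2" | "n \<ge> 3" by linarith
  then show ?thesis
    by cases (simp_all add: chi_sum_0 chi_sum_1 chi_sum_2 chi_sum_ge_3 cubic_def \<psi>_0 card_field power2_eq_square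
        del: One_nat_def)
qed

lemma chi_psi_trivial:
  assumes "n > 0"
  shows "chi_psi 0 0 0 n = q ^ n"
proof -
  have "chi_psi 0 0 0 n = (if n = 0 then 0 else q ^ n)"
  proof (rule newton_recurrence_unique[OF chi_sum_0 chi_psi_recurrence])
    fix n
    have "(\<Sum>k\<le>n. (if k = 0 then 0 else q ^ k) * chi_sum 0 0 0 (n - k)) = (\<Sum>k\<in>{1..n}. q ^ n)"
      by (rule sum.mono_neutral_cong_right) (auto simp: chi_sum_trivial simp flip: power_add)
    then show "of_nat n * chi_sum 0 0 0 n = (\<Sum>k\<le>n. (if k = 0 then 0 else q ^ k) * chi_sum 0 0 0 (n - k))"
      by (simp add: chi_sum_trivial)
  qed
  then show ?thesis using assms by simp
qed

lemma chi_psi_60_linear: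
  assumes "c1 \<noteq> 0"
  shows "chi_psi c1 0 0 60 = 0"
proof -
  have "(\<Sum>x\<in>UNIV. \<psi> (c1 * x)) = 0" using assms by (simp add: sum_\<psi>_mult)
  then have "chi_psi c1 0 0 60 = - (0 ^ 60 + 0 ^ 60)"
    by (intro chi_psi_quadratic)
      (use assms in \<open>auto simp: chi_sum_1 chi_sum_2 cubic_def simp del: One_nat_def simp flip: sum_distrib_right\<close>)
  then show ?thesis by simp
qed

lemma chi_psi_60_quadratic:
  assumes "c2 \<noteq> 0"
  shows "chi_psi c1 c2 0 60 = - (q ^ 30)"
proof -
  define s where "s = - c1 / (2 * c2)"
  define \<kappa> where "\<kappa> = \<psi> (cubic c1 c2 0 s)"
  have s: "c1 + 2 * c2 * s = 0" using assms by (simp add: s_def)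
  have shift: "cubic c1 c2 0 (s + y) = cubic c1 c2 0 s + c2 * y\<^sup>2" for y
  proof -
    have "cubic c1 c2 0 (s + y) = cubic c1 c2 0 s + c2 * y\<^sup>2 + (c1 + 2 * c2 * s) * y"
      by (simp add: cubic_def power2_eq_square algebra_simps)
    then show ?thesis by (simp add: s)
  qed
  have "(\<Sum>x\<in>UNIV. \<psi> (cubic c1 c2 0 x)) = (\<Sum>y\<in>UNIV. \<psi> (cubic c1 c2 0 (s + y)))"
    by (rule sum.reindex_bij_witness[of _ "\<lambda>y. s + y" "\<lambda>x. x - s"]) auto
  also have "\<dots> = \<kappa> * (eta c2 * gauss)"
    by (simp add: shift \<psi>_add \<kappa>_def gauss_sum[OF assms] flip: sum_distrib_left)
  finally have "chi_psi c1 c2 0 60 = - ((- (\<kappa> * (eta c2 * gauss))) ^ 60 + 0 ^ 60)"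
    by (intro chi_psi_quadratic)
      (use assms in \<open>auto simp: chi_sum_1 chi_sum_2 simp del: One_nat_def\<close>)
  also have "\<dots> = - ((\<kappa> ^ 5) ^ 12 * (eta c2 * eta c2) ^ 30 * (gauss\<^sup>2) ^ 30)"
    by (simp add: power_mult_distrib flip: power_mult power2_eq_square)
  also have "\<dots> = - (q ^ 30)"
    by (simp only: \<kappa>_def \<psi>_power_5 eta_sq[OF assms] gauss_squared) simp
  finally show ?thesis .
qed

text \<open>Completing the cube at \<open>s\<close> shows that the L-polynomial has the coefficients \<open>\<kappa> * cubic_sum c3 a\<close> and
  \<open>\<kappa>\<^sup>2 * q\<close>, where \<open>\<kappa>\<close> is a fifth root of unity. So \<open>\<kappa>\<close> is a factor of both roots, and it disappears
  from their 60th powers.\<close>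

lemma chi_psi_60_cubic:
  assumes "c3 \<noteq> 0"
  shows "chi_psi c1 c2 c3 60 = - (2 * q ^ 30)"
proof -
  define s where "s = - c2 / (3 * c3)"
  define \<kappa> where "\<kappa> = \<psi> (cubic c1 c2 c3 s)"
  define a where "a = c1 + 2 * c2 * s + 3 * c3 * s\<^sup>2"
  define X where "X = cubic_sum c3 a / gauss"
  have s: "c2 + 3 * c3 * s = 0" using assms by (simp add: s_def)
  have shift: "cubic c1 c2 c3 (s + y) = cubic c1 c2 c3 s + (c3 * y ^ 3 + a * y)" for y
  proof -
    have "cubic c1 c2 c3 (s + y) = cubic c1 c2 c3 s + (c3 * y ^ 3 + a * y) + (c2 + 3 * c3 * s) * y\<^sup>2"
      by (simp add: cubic_def a_def power2_eq_square power3_eq_cube algebra_simps)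
    then show ?thesis by (simp add: s)
  qed
  have "chi_sum c1 c2 c3 1 = (\<Sum>y\<in>UNIV. \<psi> (cubic c1 c2 c3 (s + y)))"
    unfolding chi_sum_1
    by (rule sum.reindex_bij_witness[of _ "\<lambda>y. s + y" "\<lambda>x. x - s"]) auto
  also have "\<dots> = \<kappa> * cubic_sum c3 a"
    by (simp add: shift \<psi>_add[of "cubic c1 c2 c3 s"] \<kappa>_def cubic_sum_def sum_distrib_left)
  finally have sum1: "chi_sum c1 c2 c3 1 = \<kappa> * gauss * X" using gauss_neq_0 by (simp add: X_def)
  have "2 * c2 + 3 * c3 * x = 0 \<longleftrightarrow> x = s + s" for x
  proof -
    have "2 * c2 + 3 * c3 * x = 2 * (c2 + 3 * c3 * s) + 3 * c3 * (x - (s + s))"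
      by (simp add: algebra_simps)
    then show ?thesis using assms by (simp add: s)
  qed
  then have "chi_sum c1 c2 c3 2 = \<psi> (cubic c1 c2 c3 (s + s)) * q"
    unfolding chi_sum_2 by (simp add: of_bool_def if_distrib cong: if_cong)
  also have "cubic c1 c2 c3 (s + s) = cubic c1 c2 c3 s + cubic c1 c2 c3 s"
  proof -
    have "cubic c1 c2 c3 (s + s) = cubic c1 c2 c3 s + cubic c1 c2 c3 s + 2 * s\<^sup>2 * (c2 + 3 * c3 * s)"
      by (simp add: cubic_def power2_eq_square power3_eq_cube algebra_simps)
    then show ?thesis by (simp add: s)
  qed
  finally have sum2: "chi_sum c1 c2 c3 2 = (\<kappa> * gauss)\<^sup>2"
    by (simp only: \<psi>_add power_mult_distrib gauss_squared power2_eq_square[of \<kappa>] flip: \<kappa>_def)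
  \<comment> \<open>The roots of the L-polynomial, divided by \<open>\<kappa> * gauss\<close>.\<close>
  define z where "z = (- X + csqrt (X\<^sup>2 - 4)) / 2"
  define z' where "z' = (- X - csqrt (X\<^sup>2 - 4)) / 2"
  have sq: "csqrt (X\<^sup>2 - 4) * csqrt (X\<^sup>2 - 4) = X\<^sup>2 - 4"
    by (simp flip: power2_eq_square)
  have zz: "z + z' = - X" "z * z' = 1"
    using sq by (simp_all add: z_def z'_def field_simps power2_eq_square)
  have "z\<^sup>2 + X * z + 1 = 0" "z'\<^sup>2 + X * z' + 1 = 0" using zz by algebra+
  then have z60: "z ^ 60 = 1" "z' ^ 60 = 1"
    using root_of_unity_if_trace cubic_sum_normalised[OF assms, of a] unfolding X_def by blast+
  have "chi_psi c1 c2 c3 60 = - ((\<kappa> * gauss * z) ^ 60 + (\<kappa> * gauss * z') ^ 60)"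
  proof (rule chi_psi_quadratic)
    have "\<kappa> * gauss * X = \<kappa> * gauss * - (z + z')" by (simp add: zz)
    then show "chi_sum c1 c2 c3 1 = - (\<kappa> * gauss * z + \<kappa> * gauss * z')"
      unfolding sum1 by (simp add: algebra_simps)
    have "\<kappa> * gauss * z * (\<kappa> * gauss * z') = (\<kappa> * gauss)\<^sup>2 * (z * z')"
      by (simp add: power2_eq_square mult_ac)
    then show "chi_sum c1 c2 c3 2 = \<kappa> * gauss * z * (\<kappa> * gauss * z')"
      by (simp add: sum2 zz)
  qed (use assms in auto)
  also have "\<dots> = - ((\<kappa> ^ 5) ^ 12 * (gauss\<^sup>2) ^ 30 * 2)"
    by (simp add: power_mult_distrib z60 flip: power_mult)
  also have "\<dots> = - (2 * q ^ 30)"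
    by (simp only: \<kappa>_def \<psi>_power_5 gauss_squared) simp
  finally show ?thesis .
qed

lemma chi_psi_60:
  "chi_psi c1 c2 c3 60 = q ^ 60 * of_bool (c1 = 0 \<and> c2 = 0 \<and> c3 = 0)
    - q ^ 30 * (2 - of_bool (c3 = 0) - of_bool (c2 = 0 \<and> c3 = 0))"
proof -
  consider "c3 \<noteq> 0" | "c3 = 0" "c2 \<noteq> 0" | "c3 = 0" "c2 = 0" "c1 \<noteq> 0" | "c3 = 0" "c2 = 0" "c1 = 0"
    by blast
  then show ?thesis
    by cases (simp_all add: chi_psi_60_cubic chi_psi_60_quadratic chi_psi_60_linear chi_psi_trivial)
qed

lemma sum_chars_phase:
  "(\<Sum>c1\<in>UNIV. \<Sum>c2\<in>UNIV. \<Sum>c3\<in>UNIV. \<psi> (c1 * x + c2 * y + c3 * z))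
    = q ^ 3 * of_bool (x = 0 \<and> y = 0 \<and> z = 0)"
proof -
  have "(\<Sum>c1\<in>UNIV. \<Sum>c2\<in>UNIV. \<Sum>c3\<in>UNIV. \<psi> (c1 * x + c2 * y + c3 * z))
     = (\<Sum>c1\<in>UNIV. \<psi> (x * c1)) * ((\<Sum>c2\<in>UNIV. \<psi> (y * c2)) * (\<Sum>c3\<in>UNIV. \<psi> (z * c3)))"
    by (simp add: \<psi>_add mult.assoc mult.commute[of x] mult.commute[of y] mult.commute[of z]
        sum_distrib_right flip: sum_distrib_left)
  also have "\<dots> = q ^ 3 * of_bool (x = 0 \<and> y = 0 \<and> z = 0)"
    by (simp add: sum_\<psi>_mult power3_eq_cube)
  finally show ?thesis .
qed

lemma psi_poly_fourier:
  "q ^ 3 * of_nat (psi_poly n t1 t2 t3)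
    = (\<Sum>c1\<in>UNIV. \<Sum>c2\<in>UNIV. \<Sum>c3\<in>UNIV. \<psi> (- phase c1 c2 c3 t1 t2 t3) * chi_psi c1 c2 c3 n)"
proof -
  have orth: "(\<Sum>c1\<in>UNIV. \<Sum>c2\<in>UNIV. \<Sum>c3\<in>UNIV. \<psi> (- phase c1 c2 c3 t1 t2 t3) * chi c1 c2 c3 f)
      = q ^ 3 * of_bool (next_to_leading 1 f = t1 \<and> next_to_leading 2 f = t2 \<and> next_to_leading 3 f = t3)" for f
  proof -
    define x y z where "x = t1 - next_to_leading 1 f" and "y = ((next_to_leading 1 f)\<^sup>2 - 2 * next_to_leading 2 f) - (t1\<^sup>2 - 2 * t2)"
      and "z = (- ((next_to_leading 1 f) ^ 3) + 3 * next_to_leading 1 f * next_to_leading 2 f - 3 * next_to_leading 3 f) - (- (t1 ^ 3) + 3 * t1 * t2 - 3 * t3)"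
    have "\<psi> (- phase c1 c2 c3 t1 t2 t3) * chi c1 c2 c3 f = \<psi> (c1 * x + c2 * y + c3 * z)" for c1 c2 c3
      unfolding chi_def \<psi>_add[symmetric]
      by (rule arg_cong[of _ _ \<psi>]) (simp add: phase_def x_def y_def z_def algebra_simps)
    moreover have "x = 0 \<and> y = 0 \<and> z = 0 \<longleftrightarrow> next_to_leading 1 f = t1 \<and> next_to_leading 2 f = t2 \<and> next_to_leading 3 f = t3"
      by (auto simp: x_def y_def z_def simp del: One_nat_def)
    ultimately show ?thesis by (simp add: sum_chars_phase)
  qed
  have "(\<Sum>c1\<in>UNIV. \<Sum>c2\<in>UNIV. \<Sum>c3\<in>UNIV. \<psi> (- phase c1 c2 c3 t1 t2 t3) * chi_psi c1 c2 c3 n)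
    = (\<Sum>c1\<in>UNIV. \<Sum>c2\<in>UNIV. \<Sum>c3\<in>UNIV. \<Sum>f\<in>monic_polys n.
        of_nat (mangoldt_poly f) * (\<psi> (- phase c1 c2 c3 t1 t2 t3) * chi c1 c2 c3 f))"
    by (simp add: chi_psi_def sum_distrib_left mult_ac)
  also have "\<dots> = (\<Sum>f\<in>monic_polys n. \<Sum>c1\<in>UNIV. \<Sum>c2\<in>UNIV. \<Sum>c3\<in>UNIV.
        of_nat (mangoldt_poly f) * (\<psi> (- phase c1 c2 c3 t1 t2 t3) * chi c1 c2 c3 f))"
    by (simp only: sum.swap[of _ "monic_polys n"])
  also have "\<dots> = (\<Sum>f\<in>monic_polys n. of_nat (mangoldt_poly f)
      * (q ^ 3 * of_bool (next_to_leading 1 f = t1 \<and> next_to_leading 2 f = t2 \<and> next_to_leading 3 f = t3)))"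
    by (simp only: orth flip: sum_distrib_left)
  also have "\<dots> = q ^ 3 * (\<Sum>f\<in>monic_polys n.
      if next_to_leading 1 f = t1 \<and> next_to_leading 2 f = t2 \<and> next_to_leading 3 f = t3 then of_nat (mangoldt_poly f) else 0)"
    unfolding sum_distrib_left by (intro sum.cong) auto
  also have "\<dots> = q ^ 3 * of_nat (psi_poly n t1 t2 t3)"
    unfolding psi_poly_def of_nat_sum by (subst sum.inter_filter[symmetric]) (auto simp: finite_monic_polys)
  finally show ?thesis ..
qed

theorem psi_poly_60:
  fixes t1 t2 t3 :: 'a
  shows "of_nat (psi_poly 60 t1 t2 t3) =
    q ^ 57 - q ^ 28 * (2 * q\<^sup>2 * of_bool (t1 = 0 \<and> t2 = 0 \<and> t3 = 0)
       - q * of_bool (t1 = 0 \<and> t2 = 0) - of_bool (t1 = 0))"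
proof -
  define x y z where "x = - (- t1)" and "y = - (t1\<^sup>2 - 2 * t2)"
    and "z = - (- (t1 ^ 3) + 3 * t1 * t2 - 3 * t3)"
  let ?e = "\<lambda>c1 c2 c3. \<psi> (c1 * x + c2 * y + c3 * z)"
  have e: "\<psi> (- phase c1 c2 c3 t1 t2 t3) = ?e c1 c2 c3" for c1 c2 c3
    by (rule arg_cong[of _ _ \<psi>]) (simp add: phase_def x_def y_def z_def algebra_simps)
  have iff: "x = 0 \<longleftrightarrow> t1 = 0" "x = 0 \<and> y = 0 \<longleftrightarrow> t1 = 0 \<and> t2 = 0"
    "x = 0 \<and> y = 0 \<and> z = 0 \<longleftrightarrow> t1 = 0 \<and> t2 = 0 \<and> t3 = 0"
    by (auto simp: x_def y_def z_def)
  have sum3: "(\<Sum>c1\<in>UNIV. \<Sum>c2\<in>UNIV. \<Sum>c3\<in>UNIV. ?e c1 c2 c3)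
      = q ^ 3 * of_bool (t1 = 0 \<and> t2 = 0 \<and> t3 = 0)"
    unfolding sum_chars_phase iff(3) ..
  have sum2: "(\<Sum>c1\<in>UNIV. \<Sum>c2\<in>UNIV. ?e c1 c2 0) = q\<^sup>2 * of_bool (t1 = 0 \<and> t2 = 0)"
  proof -
    have "(\<Sum>c1\<in>UNIV. \<Sum>c2\<in>UNIV. ?e c1 c2 0) = (\<Sum>c1\<in>UNIV. \<psi> (x * c1)) * (\<Sum>c2\<in>UNIV. \<psi> (y * c2))"
      by (simp add: \<psi>_add mult.commute[of x] mult.commute[of y] sum_distrib_right flip: sum_distrib_left)
    also have "\<dots> = q\<^sup>2 * of_bool (x = 0 \<and> y = 0)"
      by (simp add: sum_\<psi>_mult power2_eq_square)
    finally show ?thesis unfolding iff(2) .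
  qed
  have sum1: "(\<Sum>c1\<in>UNIV. ?e c1 0 0) = q * of_bool (t1 = 0)"
    using sum_\<psi>_mult[of x] by (simp add: iff mult.commute)
  have "q ^ 3 * of_nat (psi_poly 60 t1 t2 t3)
    = (\<Sum>c1\<in>UNIV. \<Sum>c2\<in>UNIV. \<Sum>c3\<in>UNIV. q ^ 60 * (?e c1 c2 c3 * of_bool (c1 = 0 \<and> c2 = 0 \<and> c3 = 0))
        - q ^ 30 * (2 * ?e c1 c2 c3 - ?e c1 c2 c3 * of_bool (c3 = 0)
          - ?e c1 c2 c3 * of_bool (c2 = 0 \<and> c3 = 0)))"
    unfolding psi_poly_fourier chi_psi_60 e by (intro sum.cong refl) (simp add: algebra_simps)
  also have "\<dots> = q ^ 60 - q ^ 30 * (2 * (\<Sum>c1\<in>UNIV. \<Sum>c2\<in>UNIV. \<Sum>c3\<in>UNIV. ?e c1 c2 c3)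
      - (\<Sum>c1\<in>UNIV. \<Sum>c2\<in>UNIV. ?e c1 c2 0) - (\<Sum>c1\<in>UNIV. ?e c1 0 0))"
  proof -
    have pick: "(\<Sum>c\<in>UNIV. F c * of_bool (c = 0)) = F 0" for F :: "'a \<Rightarrow> complex"
      by (simp add: of_bool_def if_distrib cong: if_cong)
    have "(\<Sum>c1\<in>UNIV. \<Sum>c2\<in>UNIV. \<Sum>c3\<in>UNIV. ?e c1 c2 c3 * of_bool (c1 = 0 \<and> c2 = 0 \<and> c3 = 0)) = 1"
      unfolding of_bool_conj mult.assoc[symmetric] pick sum_distrib_right[symmetric]
      by (simp add: mult.assoc[symmetric] pick mult.commute[of "of_bool _"] sum_distrib_right[symmetric] \<psi>_0)
    moreover have "(\<Sum>c1\<in>UNIV. \<Sum>c2\<in>UNIV. \<Sum>c3\<in>UNIV. ?e c1 c2 c3 * of_bool (c3 = 0))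
        = (\<Sum>c1\<in>UNIV. \<Sum>c2\<in>UNIV. ?e c1 c2 0)"
      by (simp only: pick)
    moreover have "(\<Sum>c1\<in>UNIV. \<Sum>c2\<in>UNIV. \<Sum>c3\<in>UNIV. ?e c1 c2 c3 * of_bool (c2 = 0 \<and> c3 = 0))
        = (\<Sum>c1\<in>UNIV. ?e c1 0 0)"
      by (simp only: of_bool_conj mult.assoc[symmetric] pick)
    ultimately show ?thesis
      by (simp only: sum_subtractf sum_distrib_left[symmetric]) simp
  qed
  also have "\<dots> = q ^ 3 * (q ^ 57 - q ^ 28 * (2 * q\<^sup>2 * of_bool (t1 = 0 \<and> t2 = 0 \<and> t3 = 0)
       - q * of_bool (t1 = 0 \<and> t2 = 0) - of_bool (t1 = 0)))"
    unfolding sum3 sum2 sum1 by (simp add: algebra_simps power_numeral_reduce)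
  finally show ?thesis using q_neq_0 by simp
qed

end

theorem corollary1p6:
  fixes t1 t2 t3 :: "'a::finite_field" and q r :: nat
  assumes "r \<ge> 1" and "q = 5 ^ r" and "CARD('a) = q"
  shows "int (psi_poly 60 t1 t2 t3) =
    int q ^ 57 - int q ^ 28 *
      (2 * int q ^ 2 * of_bool (t1 = 0 \<and> t2 = 0 \<and> t3 = 0)
       - int q * of_bool (t1 = 0 \<and> t2 = 0)
       - of_bool (t1 = 0))"
proof -
  have card: "CARD('a) = 5 ^ r" using assms by simp
  obtain \<psi> :: "'a \<Rightarrow> complex" where "\<psi> 0 = 1" "\<And>x y. \<psi> (x + y) = \<psi> x * \<psi> y"
    "\<exists>x. \<psi> x \<noteq> 1" "\<And>x. \<psi> (x ^ 5) = \<psi> x"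
    using exists_frobenius_invariant_character[OF card char_eq_5_if_card[OF card]] by blast
  then interpret frobenius_invariant_character \<psi> r
    using card by unfold_locales
  have "(of_int (int (psi_poly 60 t1 t2 t3)) :: complex) = of_int (int q ^ 57 - int q ^ 28 *
      (2 * int q ^ 2 * of_bool (t1 = 0 \<and> t2 = 0 \<and> t3 = 0)
       - int q * of_bool (t1 = 0 \<and> t2 = 0) - of_bool (t1 = 0)))"
    by (simp add: psi_poly_60 assms(2))
  then show ?thesis by (simp only: of_int_eq_iff)
qed

end
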